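(* Let $0<\delta<1/2$ and let $\epsilon_1,\epsilon_2,\ldots$ be a sequence of random variables such that $E\epsilon_i=0$ for all $1\le i<\infty$ and such that there is $\sigma>0$ for which $$n^{-1/2}\sum_{1\le i\le nt}\epsilon_i \xrightarrow{\mathcal{D}[0,1]} \sigma W(t)\qquad (n\to\infty),$$ where $\{W(t),0\le t<\infty\}$ is a Wiener process. Suppose the observations satisfy $X_k=\mu_k+\epsilon_k$, $1\le k\le n$ (the means $\mu_k$ may depend on $n$), and that the alternative $H_A$ holds: there is $1\le k^*<n$ such that $$\mu_1=\mu_2=\cdots=\mu_{k^*}\ne\mu_{k^*+1}=\cdots=\mu_n .$$ Let $\Delta_n=\mu_{k^*}-\mu_{k^*+1}$. Assume that $k^*=[n\theta]$ with some $0<\theta<1$, that $n^{1/2}|\Delta_n|\to\infty$ as $n\to\infty$, and that $\delta<\theta<1-\delta$. Then, as $n\to\infty$, $$V_{n,i}\xrightarrow{P}\infty,\qquad i=1,2,3.$$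
   Context: $\xrightarrow{\mathcal{D}[0,1]}$ denotes weak convergence in the Skorokhod space $\mathcal{D}[0,1]$; $\xrightarrow{P}\infty$ means divergence to infinity in probability; $[x]$ is the integer part of $x$. The change-point condition is understood for $n$ large enough that $1\le[n\theta]<n$. In all maxima, $k$, $i$ are integers. Partial means: $\bar X_k=\frac1k\sum_{1\le i\le k}X_i$ and $\tilde X_k=\frac{1}{n-k}\sum_{k<i\le n}X_i$. Test statistics: $$V_{n,1}=\max_{n\delta\le k\le n-n\delta}\frac{\max_{1\le i\le k}\left|\sum_{1\le j\le i}(X_j-\bar X_k)\right|}{\max_{k\le i\le n}\left|\sum_{i\le j\le n}(X_j-\tilde X_k)\right|},$$ $$V_{n,2}=\max_{n\delta\le k\le n-n\delta}\frac{\max_{1\le i\le k}\sum_{1\le j\le i}(X_j-\bar X_k)-\min_{1\le i\le k}\sum_{1\le j\le i}(X_j-\bar X_k)}{\max_{k<i\le n}\sum_{i\le j\le n}(X_j-\tilde X_k)-\min_{k<i\le n}\sum_{i\le j\le n}(X_j-\tilde X_k)},$$ $$V_{n,3}=\max_{n\delta\le k\le n-n\delta}\frac{\sum_{i=1}^{k}\left[\sum_{j=1}^{i}(X_j-\bar X_k)\right]^2-\frac1k\left[\sum_{i=1}^{k}\sum_{j=1}^{i}(X_j-\bar X_k)\right]^2}{\sum_{i=k+1}^{n}\left[\sum_{j=i}^{n}(X_j-\tilde X_k)\right]^2-\frac1{n-k}\left[\sum_{i=k+1}^{n}\sum_{j=i}^{n}(X_j-\tilde X_k)\right]^2}.$$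 *)

theory Defs
  imports "HOL-Probability.Probability"
begin

section \<open>The Skorokhod space of functions on the unit interval\<close>

text \<open>
  Right-continuous functions with left limits on \<open>[0,1]\<close>. They are required to be extensional
  (\<open>undefined\<close> outside \<open>[0,1]\<close>), so that elements are determined by their values on \<open>[0,1]\<close> and
  the Skorokhod distance separates points.
\<close>

definition skorokhod_space :: "(real \<Rightarrow> real) set" where
  "skorokhod_space = {x \<in> extensional {0..1}.
     (\<forall>t\<in>{0..<1}. (x \<longlongrightarrow> x t) (at_right t)) \<and>
     (\<forall>t\<in>{0<..1}. \<exists>l. (x \<longlongrightarrow> l) (at_left t))}"

definition time_changes :: "(real \<Rightarrow> real) set" where
  "time_changes = {l. strict_mono_on {0..1} l \<and> continuous_on {0..1} l \<and> l ` {0..1} = {0..1}}"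

definition skorokhod_close :: "real \<Rightarrow> (real \<Rightarrow> real) \<Rightarrow> (real \<Rightarrow> real) \<Rightarrow> bool" where
  "skorokhod_close e x y \<longleftrightarrow>
     (\<exists>l\<in>time_changes. (\<forall>t\<in>{0..1}. \<bar>l t - t\<bar> \<le> e) \<and> (\<forall>t\<in>{0..1}. \<bar>x t - y (l t)\<bar> \<le> e))"

text \<open>
  On the space the set below is nonempty, since its elements are bounded. The value \<open>0\<close> off the
  space is a dummy: the locale \<^locale>\<open>Metric_space\<close> demands nonnegativity for all arguments.
\<close>

definition skorokhod_dist :: "(real \<Rightarrow> real) \<Rightarrow> (real \<Rightarrow> real) \<Rightarrow> real" where
  "skorokhod_dist x y =
     (if x \<in> skorokhod_space \<and> y \<in> skorokhod_space
      then Inf {e. 0 < e \<and> skorokhod_close e x y} else 0)"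

lemma time_changes_endpoints:
  assumes "l \<in> time_changes"
  shows "l 0 = 0" "l 1 = 1"
proof -
  have sm: "strict_mono_on {0..1} l" and im: "l ` {0..1} = {0..1}"
    using assms by (auto simp: time_changes_def)
  note mono = strict_mono_on_imp_mono_on[OF sm]
  obtain a where a: "a \<in> {0..1}" "l a = 0" using im by (metis atLeastAtMost_iff imageE order_refl zero_le_one)
  obtain b where b: "b \<in> {0..1}" "l b = 1" using im by (metis atLeastAtMost_iff imageE order_refl zero_le_one)
  have "l 0 \<in> {0..1}" "l 1 \<in> {0..1}" using im by auto
  moreover have "l 0 \<le> l a" "l b \<le> l 1"
    using mono_onD[OF mono, of 0 a] mono_onD[OF mono, of b 1] a b by auto
  ultimately show "l 0 = 0" "l 1 = 1" using a b by auto
qed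

lemma time_changes_inverse:
  assumes "l \<in> time_changes"
  obtains m where "m \<in> time_changes" "\<And>t. t \<in> {0..1} \<Longrightarrow> m (l t) = t"
    "\<And>t. t \<in> {0..1} \<Longrightarrow> l (m t) = t"
proof -
  have sm: "strict_mono_on {0..1} l" and im: "l ` {0..1} = {0..1}" and cont: "continuous_on {0..1} l"
    using assms by (auto simp: time_changes_def)
  have inj: "inj_on l {0..1}" using sm by (rule strict_mono_on_imp_inj_on)
  define m where "m = inv_into {0..1} l"
  have ml: "m (l t) = t" if "t \<in> {0..1}" for t
    using inj that by (simp add: m_def)
  have lm: "l (m t) = t" if "t \<in> {0..1}" for t
    using that im by (simp add: m_def f_inv_into_f)
  have mr: "m t \<in> {0..1}" if "t \<in> {0..1}" for t
    using that im unfolding m_def by (metis inv_into_into)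
  have c: "continuous_on {0..1} m"
    using continuous_on_inv[OF cont compact_Icc, of m] ml im by auto
  have "strict_mono_on {0..1} m"
  proof (rule strict_mono_onI)
    fix r s :: real assume rs: "r \<in> {0..1}" "s \<in> {0..1}" "r < s"
    show "m r < m s"
    proof (rule ccontr)
      assume "\<not> m r < m s"
      then have "l (m s) \<le> l (m r)"
        using mono_onD[OF strict_mono_on_imp_mono_on[OF sm], of "m s" "m r"] mr rs by force
      then show False using rs lm by auto
    qed
  qed
  moreover have "m ` {0..1} = {0..1}"
  proof (intro equalityI subsetI)
    fix t :: real assume "t \<in> {0..1}"
    then have "l t \<in> {0..1}" "t = m (l t)" using im ml by auto
    then show "t \<in> m ` {0..1}" by blast
  qed (use mr in blast)
  ultimately have "m \<in> time_changes" using c unfolding time_changes_def by blast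
  then show ?thesis using that ml lm by blast
qed

lemma time_changes_compose:
  assumes "l \<in> time_changes" "m \<in> time_changes"
  shows "m \<circ> l \<in> time_changes"
proof -
  have l: "strict_mono_on {0..1} l" "l ` {0..1} = {0..1}" "continuous_on {0..1} l"
   and m: "strict_mono_on {0..1} m" "m ` {0..1} = {0..1}" "continuous_on {0..1} m"
    using assms by (auto simp: time_changes_def)
  have "l t \<in> {0..1}" if "t \<in> {0..1}" for t using that l(2) by blast
  then have "strict_mono_on {0..1} (m \<circ> l)"
    using strict_mono_onD[OF l(1)] strict_mono_onD[OF m(1)] by (intro strict_mono_onI) (metis o_apply)
  moreover have "continuous_on {0..1} (m \<circ> l)"
    by (intro continuous_on_compose) (simp_all only: l m)
  moreover have "(m \<circ> l) ` {0..1} = {0..1}" by (simp only: image_comp[symmetric] l(2) m(2))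
  ultimately show ?thesis unfolding time_changes_def by blast
qed

lemma skorokhod_close_sym:
  assumes "skorokhod_close e x y" shows "skorokhod_close e y x"
proof -
  obtain l where l: "l \<in> time_changes" "\<forall>t\<in>{0..1}. \<bar>l t - t\<bar> \<le> e" "\<forall>t\<in>{0..1}. \<bar>x t - y (l t)\<bar> \<le> e"
    using assms by (auto simp: skorokhod_close_def)
  obtain m where m: "m \<in> time_changes" "\<And>t. t \<in> {0..1} \<Longrightarrow> l (m t) = t"
    using time_changes_inverse[OF l(1)] by metis
  have r: "m t \<in> {0..1}" if "t \<in> {0..1}" for t using m(1) that by (auto simp: time_changes_def)
  have "\<bar>m t - t\<bar> \<le> e \<and> \<bar>y t - x (m t)\<bar> \<le> e" if "t \<in> {0..1}" for t
    using l(2,3) r[OF that] m(2)[OF that] by (metis abs_minus_commute)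
  then show ?thesis using m(1) unfolding skorokhod_close_def by (intro bexI[of _ m]) blast+
qed

lemma skorokhod_close_trans:
  assumes "skorokhod_close e x y" "skorokhod_close e' y z" shows "skorokhod_close (e + e') x z"
proof -
  obtain l where l: "l \<in> time_changes" "\<forall>t\<in>{0..1}. \<bar>l t - t\<bar> \<le> e" "\<forall>t\<in>{0..1}. \<bar>x t - y (l t)\<bar> \<le> e"
    using assms by (auto simp: skorokhod_close_def)
  obtain m where m: "m \<in> time_changes" "\<forall>t\<in>{0..1}. \<bar>m t - t\<bar> \<le> e'" "\<forall>t\<in>{0..1}. \<bar>y t - z (m t)\<bar> \<le> e'"
    using assms by (auto simp: skorokhod_close_def)
  have r: "l t \<in> {0..1}" if "t \<in> {0..1}" for t using l(1) that by (auto simp: time_changes_def)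
  have "\<bar>(m \<circ> l) t - t\<bar> \<le> e + e' \<and> \<bar>x t - z ((m \<circ> l) t)\<bar> \<le> e + e'" if "t \<in> {0..1}" for t
    using l(2,3)[rule_format, OF that] m(2,3)[rule_format, OF r[OF that]] unfolding o_def by linarith
  then show ?thesis using time_changes_compose[OF l(1) m(1)]
    unfolding skorokhod_close_def by (intro bexI[of _ "m \<circ> l"]) blast+
qed

lemma skorokhod_space_bounded:
  assumes "x \<in> skorokhod_space"
  obtains B where "B > 0" "\<And>t. t \<in> {0..1} \<Longrightarrow> \<bar>x t\<bar> \<le> B"
proof -
  have loc: "\<exists>U B. open U \<and> t \<in> U \<and> (\<forall>s\<in>U \<inter> {0..1}. \<bar>x s\<bar> \<le> B)" if t: "t \<in> {0..1}" for t
  proof -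
    obtain b B1 where R: "b > t" "\<And>s. t < s \<Longrightarrow> s < b \<Longrightarrow> s \<le> 1 \<Longrightarrow> \<bar>x s\<bar> \<le> B1"
    proof (cases "t < 1")
      case True
      then have "(x \<longlongrightarrow> x t) (at_right t)" using assms t by (auto simp: skorokhod_space_def)
      then have "\<forall>\<^sub>F s in at_right t. dist (x s) (x t) < 1" by (rule tendstoD) simp
      then obtain b where "b > t" "\<forall>s>t. s < b \<longrightarrow> dist (x s) (x t) < 1"
        unfolding eventually_at_right_field by auto
      then show ?thesis by (intro that[of b "\<bar>x t\<bar> + 1"]) (force simp: dist_real_def)+
    next
      case False then show ?thesis using t by (intro that[of 2 0]) auto
    qed
    obtain a B2 where L: "a < t" "\<And>s. a < s \<Longrightarrow> s < t \<Longrightarrow> s \<ge> 0 \<Longrightarrow> \<bar>x s\<bar> \<le> B2"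
    proof (cases "t > 0")
      case True
      then have "\<exists>l. (x \<longlongrightarrow> l) (at_left t)" using assms t by (simp add: skorokhod_space_def)
      then obtain l where "(x \<longlongrightarrow> l) (at_left t)" by blast
      then have "\<forall>\<^sub>F s in at_left t. dist (x s) l < 1" by (rule tendstoD) simp
      then obtain a where "a < t" "\<forall>s>a. s < t \<longrightarrow> dist (x s) l < 1"
        unfolding eventually_at_left_field by auto
      then show ?thesis by (intro that[of a "\<bar>l\<bar> + 1"]) (force simp: dist_real_def)+
    next
      case False then show ?thesis using t by (intro that[of "-1" 0]) auto
    qed
    have "\<bar>x s\<bar> \<le> max \<bar>x t\<bar> (max B1 B2)" if "s \<in> {a<..<b} \<inter> {0..1}" for s
      using that R(2)[of s] L(2)[of s] by (cases s t rule: linorder_cases) auto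
    then show ?thesis using R(1) L(1)
      by (intro exI[of _ "{a<..<b}"] exI[of _ "max \<bar>x t\<bar> (max B1 B2)"]) auto
  qed
  then obtain U B where UB: "\<And>t. t \<in> {0..1} \<Longrightarrow> open (U t) \<and> t \<in> U t \<and> (\<forall>s\<in>U t \<inter> {0..1}. \<bar>x s\<bar> \<le> (B t :: real))"
    by metis
  obtain T where T: "T \<subseteq> {0..1}" "finite T" "{0..1} \<subseteq> (\<Union>t\<in>T. U t)"
    using compactE_image[OF compact_Icc[of 0 "1::real"], of "{0..1}" U] UB by blast
  define C where "C = 1 + (\<Sum>t\<in>T. \<bar>B t\<bar>)"
  show ?thesis
  proof (rule that[of C])
    show "C > 0" unfolding C_def by (intro add_pos_nonneg sum_nonneg) auto
    fix s :: real assume s: "s \<in> {0..1}"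
    then obtain t where t: "t \<in> T" "s \<in> U t" using T(3) by blast
    then have "\<bar>x s\<bar> \<le> B t" using UB[of t] T(1) s by auto
    also have "\<dots> \<le> \<bar>B t\<bar>" by simp
    also have "\<dots> \<le> (\<Sum>t\<in>T. \<bar>B t\<bar>)" using t(1) T(2) by (intro member_le_sum) auto
    finally show "\<bar>x s\<bar> \<le> C" by (simp add: C_def)
  qed
qed

lemma id_time_change: "(\<lambda>t. t) \<in> time_changes"
  by (auto simp: time_changes_def strict_mono_on_def)

lemma skorokhod_close_exists:
  assumes "x \<in> skorokhod_space" "y \<in> skorokhod_space"
  obtains e where "0 < e" "skorokhod_close e x y"
proof -
  obtain B C where B: "B > 0" "\<And>t. t \<in> {0..1} \<Longrightarrow> \<bar>x t\<bar> \<le> B"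
    and C: "C > 0" "\<And>t. t \<in> {0..1} \<Longrightarrow> \<bar>y t\<bar> \<le> C"
    using skorokhod_space_bounded assms by metis
  have "\<bar>x t - y t\<bar> \<le> B + C" if "t \<in> {0..1}" for t
    using B(2)[OF that] C(2)[OF that] by linarith
  then have "skorokhod_close (B + C) x y"
    using id_time_change B(1) C(1) unfolding skorokhod_close_def by (intro bexI[of _ "\<lambda>t. t"]) auto
  then show ?thesis using B C that[of "B + C"] by auto
qed

lemma skorokhod_dist_less_iff:
  assumes "x \<in> skorokhod_space" "y \<in> skorokhod_space"
  shows "skorokhod_dist x y < e \<longleftrightarrow> (\<exists>e'<e. 0 < e' \<and> skorokhod_close e' x y)"
proof -
  have "{e. 0 < e \<and> skorokhod_close e x y} \<noteq> {}" using skorokhod_close_exists[OF assms] by blast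
  then have "Inf {e. 0 < e \<and> skorokhod_close e x y} < e \<longleftrightarrow>
      (\<exists>e'\<in>{e. 0 < e \<and> skorokhod_close e x y}. e' < e)"
    by (intro cInf_less_iff bdd_belowI[of _ 0]) auto
  then show ?thesis using assms by (auto simp: skorokhod_dist_def)
qed

lemma skorokhod_dist_zero_imp_eq:
  assumes x: "x \<in> skorokhod_space" and y: "y \<in> skorokhod_space" and 0: "skorokhod_dist x y \<le> 0"
  shows "x = y"
proof -
  have close: "\<exists>l\<in>time_changes. (\<forall>t\<in>{0..1}. \<bar>l t - t\<bar> \<le> e) \<and> (\<forall>t\<in>{0..1}. \<bar>x t - y (l t)\<bar> \<le> e)"
    if "e > 0" for e
  proof -
    have "skorokhod_dist x y < e" using 0 that by simp
    then obtain e' where "e' < e" "skorokhod_close e' x y" using skorokhod_dist_less_iff[OF x y] by auto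
    then show ?thesis unfolding skorokhod_close_def by (meson less_le_not_le order.trans)
  qed
  \<comment> \<open>Each value of \<open>x\<close> is within any \<open>e\<close> of some value of \<open>y\<close> at an arbitrarily near point.\<close>
  have near: "\<exists>u\<in>{0..1}. \<bar>u - t\<bar> \<le> e \<and> \<bar>x t - y u\<bar> \<le> e" if et: "e > 0" "t \<in> {0..1}" for e t
  proof -
    obtain l where l: "l \<in> time_changes" "\<forall>t\<in>{0..1}. \<bar>l t - t\<bar> \<le> e" "\<forall>t\<in>{0..1}. \<bar>x t - y (l t)\<bar> \<le> e"
      using close[OF et(1)] by auto
    have "l t \<in> {0..1}" using l(1) et(2) by (auto simp: time_changes_def)
    then show ?thesis using l(2,3) et(2) by blast
  qed
  have eq1: "x 1 = y 1"
  proof (rule ccontr)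
    assume "x 1 \<noteq> y 1"
    then have "\<bar>x 1 - y 1\<bar> / 2 > 0" by simp
    from close[OF this] obtain l where "l \<in> time_changes" "\<forall>t\<in>{0..1}. \<bar>x t - y (l t)\<bar> \<le> \<bar>x 1 - y 1\<bar> / 2"
      by auto
    then have "l 1 = 1" "\<bar>x 1 - y (l 1)\<bar> \<le> \<bar>x 1 - y 1\<bar> / 2"
      using time_changes_endpoints(2) by (blast, simp)
    then have "\<bar>x 1 - y 1\<bar> \<le> \<bar>x 1 - y 1\<bar> / 2" by simp
    then show False using \<open>x 1 \<noteq> y 1\<close> by simp
  qed
  have eq: "x t = y t" if t: "t \<in> {0..<1}" for t
  proof (rule ccontr)
    assume ne: "x t \<noteq> y t"
    define d where "d = \<bar>x t - y t\<bar> / 4"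
    have d: "d > 0" using ne by (simp add: d_def)
    have xr: "(x \<longlongrightarrow> x t) (at_right t)" and yr: "(y \<longlongrightarrow> y t) (at_right t)"
      using x y t by (auto simp: skorokhod_space_def)
    obtain b where b: "b > t" "\<forall>s>t. s < b \<longrightarrow> dist (x s) (x t) < d"
      using tendstoD[OF xr d] unfolding eventually_at_right_field by auto
    obtain c where c: "c > t" "\<forall>s>t. s < c \<longrightarrow> dist (y s) (y t) < d"
      using tendstoD[OF yr d] unfolding eventually_at_right_field by auto
    define r where "r = min 1 (min b c) - t"
    have r: "r > 0" using b c t by (auto simp: r_def)
    define s where "s = t + r / 2"
    have rr: "r \<le> 1 - t" "r \<le> b - t" "r \<le> c - t" by (auto simp: r_def)
    have s: "s \<in> {0..1}" "t < s" "s < b" "s < c"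
      unfolding s_def atLeastAtMost_iff using r rr t by (auto simp: field_simps)
    define e where "e = min d (r / 4)"
    have e: "e > 0" using d r by (simp add: e_def)
    obtain u where u: "u \<in> {0..1}" "\<bar>u - s\<bar> \<le> e" "\<bar>x s - y u\<bar> \<le> e" using near[OF e s(1)] by auto
    have "e \<le> r / 4" unfolding e_def by (rule min.cobounded2)
    then have "t < u" "u < c" using u(2) r rr unfolding s_def abs_le_iff by linarith+
    then have "\<bar>y u - y t\<bar> < d" using c(2) by (auto simp: dist_real_def)
    moreover have "\<bar>x s - x t\<bar> < d" using b(2) s by (auto simp: dist_real_def)
    moreover have "\<bar>x s - y u\<bar> \<le> d" using u(3) by (simp add: e_def)
    ultimately have "\<bar>x t - y t\<bar> < 3 * d" by linarith
    then show False using d by (simp add: d_def)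
  qed
  show "x = y"
  proof (rule extensionalityI[of _ "{0..1}"])
    show "x \<in> extensional {0..1}" "y \<in> extensional {0..1}" using x y by (auto simp: skorokhod_space_def)
    show "x t = y t" if "t \<in> {0..1}" for t using that eq[of t] eq1 by (cases "t = 1") auto
  qed
qed

lemma skorokhod_dist_nonneg: "0 \<le> skorokhod_dist x y"
  using skorokhod_dist_less_iff[of x y 0] by (force simp: skorokhod_dist_def)

interpretation skorokhod: Metric_space skorokhod_space skorokhod_dist
proof
  show "0 \<le> skorokhod_dist x y" for x y by (rule skorokhod_dist_nonneg)
  show "skorokhod_dist x y = skorokhod_dist y x" for x y
  proof -
    have "{e. 0 < e \<and> skorokhod_close e x y} = {e. 0 < e \<and> skorokhod_close e y x}"
      using skorokhod_close_sym by blast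
    then show ?thesis by (simp add: skorokhod_dist_def)
  qed
  show "skorokhod_dist x y = 0 \<longleftrightarrow> x = y" if "x \<in> skorokhod_space" "y \<in> skorokhod_space" for x y
  proof
    assume "x = y"
    have "skorokhod_close e y y" if "e > 0" for e
      using that id_time_change unfolding skorokhod_close_def by (intro bexI[of _ "\<lambda>t. t"]) auto
    then have "skorokhod_dist x y < e" if "e > 0" for e
      using that skorokhod_dist_less_iff[of x y e] \<open>x = y\<close> \<open>y \<in> skorokhod_space\<close> field_lbound_gt_zero
      by (metis dense)
    then have "skorokhod_dist x y \<le> 0" by (meson less_irrefl not_le)
    then show "skorokhod_dist x y = 0" using skorokhod_dist_nonneg[of x y] by simp
  qed (use that skorokhod_dist_zero_imp_eq in auto)
  show "skorokhod_dist x z \<le> skorokhod_dist x y + skorokhod_dist y z"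
    if S: "x \<in> skorokhod_space" "y \<in> skorokhod_space" "z \<in> skorokhod_space" for x y z
  proof (rule field_le_epsilon)
    fix e :: real assume e: "e > 0"
    then have "skorokhod_dist x y < skorokhod_dist x y + e / 2" "skorokhod_dist y z < skorokhod_dist y z + e / 2"
      by auto
    then obtain a b where "a < skorokhod_dist x y + e / 2" "0 < a" "skorokhod_close a x y"
      "b < skorokhod_dist y z + e / 2" "0 < b" "skorokhod_close b y z"
      using skorokhod_dist_less_iff S by meson
    then have "skorokhod_dist x z < skorokhod_dist x y + skorokhod_dist y z + e"
      unfolding skorokhod_dist_less_iff[OF S(1,3)]
      by (intro exI[of _ "a + b"]) (auto intro: skorokhod_close_trans)
    then show "skorokhod_dist x z \<le> skorokhod_dist x y + skorokhod_dist y z + e" by simp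
  qed
qed

definition skorokhod_borel :: "(real \<Rightarrow> real) measure" where
  "skorokhod_borel = sigma skorokhod_space {U. openin skorokhod.mtopology U}"

text \<open>
  Convergence in distribution; the limit may live on a probability space of its own. The
  measurability conditions say that the processes are random elements of the space, so that the
  expectations are genuine integrals.
\<close>

definition converges_weakly_skorokhod ::
  "'a measure \<Rightarrow> (nat \<Rightarrow> 'a \<Rightarrow> real \<Rightarrow> real) \<Rightarrow> 'b measure \<Rightarrow> ('b \<Rightarrow> real \<Rightarrow> real) \<Rightarrow> bool" where
  "converges_weakly_skorokhod M Y N Z \<longleftrightarrow>
     (\<forall>n. Y n \<in> measurable M skorokhod_borel) \<and> Z \<in> measurable N skorokhod_borel \<and>
     (\<forall>f. continuous_map skorokhod.mtopology euclideanreal f \<and> bounded (f ` skorokhod_space) \<longrightarrow>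
        (\<lambda>n. \<integral>\<omega>. f (Y n \<omega>) \<partial>M) \<longlonglongrightarrow> (\<integral>\<omega>. f (Z \<omega>) \<partial>N))"

section \<open>Wiener process and partial sum process\<close>

definition wiener_process :: "'b measure \<Rightarrow> (real \<Rightarrow> 'b \<Rightarrow> real) \<Rightarrow> bool" where
  "wiener_process N W \<longleftrightarrow>
     prob_space N \<and>
     (\<forall>t\<ge>0. W t \<in> borel_measurable N) \<and>
     (\<forall>\<omega>\<in>space N. W 0 \<omega> = 0) \<and>
     (\<forall>\<omega>\<in>space N. continuous_on {0..} (\<lambda>t. W t \<omega>)) \<and>
     (\<forall>s t. 0 \<le> s \<and> s < t \<longrightarrow>
        distributed N lborel (\<lambda>\<omega>. W t \<omega> - W s \<omega>) (normal_density 0 (sqrt (t - s)))) \<and>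
     (\<forall>m (s :: nat \<Rightarrow> real). 0 \<le> s 0 \<and> strict_mono_on {..m} s \<longrightarrow>
        prob_space.indep_vars N (\<lambda>_. borel) (\<lambda>i \<omega>. W (s (Suc i)) \<omega> - W (s i) \<omega>) {..<m})"

definition partial_sum_process :: "(nat \<Rightarrow> 'a \<Rightarrow> real) \<Rightarrow> nat \<Rightarrow> 'a \<Rightarrow> real \<Rightarrow> real" where
  "partial_sum_process \<epsilon> n \<omega> =
     restrict (\<lambda>t. (\<Sum>i | 1 \<le> i \<and> real i \<le> real n * t. \<epsilon> i \<omega>) / sqrt (real n)) {0..1}"

section \<open>Change-point model and test statistics\<close>

definition change_point :: "nat \<Rightarrow> (nat \<Rightarrow> real) \<Rightarrow> nat \<Rightarrow> bool" where
  "change_point n \<mu> k \<longleftrightarrow> 1 \<le> k \<and> k < n \<and>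
     (\<forall>i\<in>{1..k}. \<mu> i = \<mu> k) \<and> (\<forall>i\<in>{k+1..n}. \<mu> i = \<mu> (k + 1)) \<and> \<mu> k \<noteq> \<mu> (k + 1)"

definition left_mean :: "(nat \<Rightarrow> real) \<Rightarrow> nat \<Rightarrow> real" where
  "left_mean x k = (\<Sum>i=1..k. x i) / real k"

definition right_mean :: "nat \<Rightarrow> (nat \<Rightarrow> real) \<Rightarrow> nat \<Rightarrow> real" where
  "right_mean n x k = (\<Sum>i=k+1..n. x i) / real (n - k)"

definition left_sum :: "(nat \<Rightarrow> real) \<Rightarrow> nat \<Rightarrow> nat \<Rightarrow> real" where
  "left_sum x k i = (\<Sum>j=1..i. (x j - left_mean x k))"

definition right_sum :: "nat \<Rightarrow> (nat \<Rightarrow> real) \<Rightarrow> nat \<Rightarrow> nat \<Rightarrow> real" where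
  "right_sum n x k i = (\<Sum>j=i..n. (x j - right_mean n x k))"

definition trimmed :: "real \<Rightarrow> nat \<Rightarrow> nat set" where
  "trimmed \<delta> n = {k. real n * \<delta> \<le> real k \<and> real k \<le> real n - real n * \<delta>}"

text \<open>
  A ratio with vanishing denominator counts as \<open>0\<close>. As all ratios are nonnegative, any
  other nonnegative convention (such as \<open>\<infinity>\<close>) only makes the statistics larger. For small \<open>n\<close> the set
  \<^term>\<open>trimmed \<delta> n\<close> may be empty, in which case the maxima are unspecified.
\<close>

definition V1 :: "real \<Rightarrow> nat \<Rightarrow> (nat \<Rightarrow> real) \<Rightarrow> real" where
  "V1 \<delta> n x = Max ((\<lambda>k.
       Max ((\<lambda>i. \<bar>left_sum x k i\<bar>) ` {1..k})
     / Max ((\<lambda>i. \<bar>right_sum n x k i\<bar>) ` {k..n})) ` trimmed \<delta> n)"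

definition V2 :: "real \<Rightarrow> nat \<Rightarrow> (nat \<Rightarrow> real) \<Rightarrow> real" where
  "V2 \<delta> n x = Max ((\<lambda>k.
       (Max ((\<lambda>i. left_sum x k i) ` {1..k}) - Min ((\<lambda>i. left_sum x k i) ` {1..k}))
     / (Max ((\<lambda>i. right_sum n x k i) ` {k+1..n}) - Min ((\<lambda>i. right_sum n x k i) ` {k+1..n})))
     ` trimmed \<delta> n)"

definition V3 :: "real \<Rightarrow> nat \<Rightarrow> (nat \<Rightarrow> real) \<Rightarrow> real" where
  "V3 \<delta> n x = Max ((\<lambda>k.
       ((\<Sum>i=1..k. (left_sum x k i)\<^sup>2) - 1 / real k * (\<Sum>i=1..k. left_sum x k i)\<^sup>2)
     / ((\<Sum>i=k+1..n. (right_sum n x k i)\<^sup>2)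
          - 1 / real (n - k) * (\<Sum>i=k+1..n. right_sum n x k i)\<^sup>2))
     ` trimmed \<delta> n)"

definition diverges_in_probability :: "'a measure \<Rightarrow> (nat \<Rightarrow> 'a \<Rightarrow> real) \<Rightarrow> bool" where
  "diverges_in_probability M V \<longleftrightarrow>
     (\<forall>c. (\<lambda>n. measure M {\<omega> \<in> space M. V n \<omega> > c}) \<longlonglongrightarrow> 1)"

end

theory Submission
  imports Defs
begin

text \<open>
  Each statistic is a maximum over \<open>k\<close>, so a single well-chosen \<open>k\<close> suffices. Put the split point
  at \<open>k = \<lfloor>n s\<rfloor>\<close> with a fixed \<open>\<theta> < s < 1 - \<delta>\<close>, strictly after the change. The observations to the
  right of \<open>k\<close> have a constant mean, so the right sums are made of noise alone and are at most of
  the order of \<open>\<surd>n\<close>. The observations to the left of \<open>k\<close> contain the change, and their centered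
  partial sums follow a tent of height proportional to \<open>n \<bar>\<Delta> n\<bar>\<close>. The ratio is therefore at least of
  the order of \<open>\<surd>n \<bar>\<Delta> n\<bar>\<close> for the first two statistics, and of its square for the third.

  One more fact is needed: a ratio with denominator \<open>0\<close> counts as \<open>0\<close>, so the denominators must be
  shown to be positive with high probability. They vanish only if the errors after \<open>k\<close> are all equal,
  that is, if the partial sums are affine in the index from \<open>k\<close> on. Then the partial sum process
  has a second difference close to \<open>0\<close> at the times \<open>s\<close>, \<open>(1 + s) / 2\<close> and \<open>1\<close>, whereas the second
  difference of the limit is a nondegenerate normal variable.

  The probabilistic input is thus a single statement,
  \<open>eventually_exceptional_paths_unlikely\<close>: for some \<open>r\<close> and all large \<open>n\<close>, with probability close to
  \<open>1\<close>, the partial sum process is bounded by \<open>r\<close> and its second difference is at least \<open>1 / r\<close>. It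
  comes from testing weak convergence against a continuous function that separates the exceptional
  paths from most paths of the limit. On such an event everything is deterministic: the estimate
  \<open>statistics_ge_of_large_change\<close> bounds all three statistics from below for a fixed \<open>n\<close>, and
  \<open>eventually_statistics_large\<close> checks that its conditions hold for all large \<open>n\<close>.
\<close>

section \<open>Algebra of the partial sums\<close>

lemma left_sum_eq:
  "left_sum x k i = (\<Sum>j=1..i. x j) - real i / real k * (\<Sum>j=1..k. x j)"
  by (simp add: left_sum_def left_mean_def sum_subtractf)

lemma right_sum_eq:
  assumes "i \<le> n + 1"
  shows "right_sum n x k i = (\<Sum>j=i..n. x j) - (real n + 1 - real i) / real (n - k) * (\<Sum>j=k+1..n. x j)"
  using assms by (simp add: right_sum_def right_mean_def sum_subtractf of_nat_diff)

lemma sum_atLeastAtMost_diff: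
  fixes e :: "nat \<Rightarrow> real"
  assumes "1 \<le> i" "i \<le> n + 1"
  shows "(\<Sum>j=i..n. e j) = (\<Sum>j=1..n. e j) - (\<Sum>j=1..i-1. e j)"
proof -
  have "{1..n} = {1..i-1} \<union> {i..n}" "{1..i-1} \<inter> {i..n} = {}" using assms by auto
  then show ?thesis by (simp add: sum.union_disjoint)
qed

text \<open>
  Up to the change \<open>q\<close>, the centered partial sums of the means increase linearly: every summand is
  the difference between the first mean and the average of the means over \<open>{1..k}\<close>. This is the
  rising side of the tent.
\<close>

lemma left_sum_change_point:
  assumes before: "\<And>j. j \<in> {1..q} \<Longrightarrow> x j = a + e j" and after: "\<And>j. j \<in> {q+1..k} \<Longrightarrow> x j = b + e j"
    and "i \<le> q" "q \<le> k" "0 < k"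
  shows "left_sum x k i = real i * ((real k - real q) / real k * (a - b)) + left_sum e k i"
proof -
  have "(\<Sum>j=1..i. x j) = (\<Sum>j=1..i. a + e j)" using assms(3) by (intro sum.cong before) auto
  then have *: "(\<Sum>j=1..i. x j) = real i * a + (\<Sum>j=1..i. e j)" by (simp add: sum.distrib)
  have split: "{1..k} = {1..q} \<union> {q+1..k}" "{1..q} \<inter> {q+1..k} = {}" using assms by auto
  have "(\<Sum>j=1..k. x j) = (\<Sum>j=1..q. x j) + (\<Sum>j=q+1..k. x j)"
    using split by (simp add: sum.union_disjoint)
  also have "\<dots> = (\<Sum>j=1..q. a + e j) + (\<Sum>j=q+1..k. b + e j)"
    using before after by (intro arg_cong2[of _ _ _ _ "(+)"] sum.cong) auto
  also have "\<dots> = real q * a + (real k - real q) * b + ((\<Sum>j=1..q. e j) + (\<Sum>j=q+1..k. e j))"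
    using assms by (simp add: sum.distrib of_nat_diff)
  also have "(\<Sum>j=1..q. e j) + (\<Sum>j=q+1..k. e j) = (\<Sum>j=1..k. e j)"
    using split by (simp add: sum.union_disjoint)
  finally have **: "(\<Sum>j=1..k. x j) = real q * a + (real k - real q) * b + (\<Sum>j=1..k. e j)" .
  show ?thesis
    unfolding left_sum_eq * ** using assms(5) by (simp add: field_simps)
qed

lemma right_sum_shift:
  assumes "\<And>j. j \<in> {i..n} \<union> {k+1..n} \<Longrightarrow> x j = b + e j" "k < n"
  shows "right_sum n x k i = right_sum n e k i"
proof -
  have "(\<Sum>j=k+1..n. x j) = (\<Sum>j=k+1..n. b + e j)" using assms by (intro sum.cong) auto
  then have "right_mean n x k = b + right_mean n e k"
    using assms(2) by (simp add: right_mean_def sum.distrib add_divide_distrib)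
  then show ?thesis unfolding right_sum_def using assms(1) by (intro sum.cong) auto
qed

lemma left_sum_full [simp]: "left_sum x k k = 0"
  by (cases "k = 0") (simp_all add: left_sum_eq)

lemma right_sum_full [simp]: "k < n \<Longrightarrow> right_sum n x k (Suc k) = 0"
  by (simp add: right_sum_eq of_nat_diff)

lemma abs_left_sum_le:
  assumes R: "\<And>j. j \<le> k \<Longrightarrow> \<bar>\<Sum>m=1..j. e m\<bar> \<le> R" and "i \<le> k" "0 < k"
  shows "\<bar>left_sum e k i\<bar> \<le> 2 * R"
proof -
  have "real i / real k \<le> 1" using assms by simp
  then have "real i / real k * \<bar>\<Sum>m=1..k. e m\<bar> \<le> 1 * R"
    using R[of k] by (intro mult_mono) auto
  then have "\<bar>real i / real k * (\<Sum>m=1..k. e m)\<bar> \<le> R" by (simp add: abs_mult)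
  then show ?thesis unfolding left_sum_eq mult_2
    by (intro order_trans[OF abs_triangle_ineq4] add_mono R assms(2))
qed

text \<open>
  The sum starts at the index \<open>k\<close> itself in the first statistic, one step before the range over which
  the mean is taken. Hence the weight of the mean may exceed \<open>1\<close>, but it is at most \<open>2\<close>; this is why the
  constant is \<open>6\<close> rather than \<open>4\<close>.
\<close>

lemma abs_right_sum_le:
  assumes R: "\<And>j. j \<le> n \<Longrightarrow> \<bar>\<Sum>m=1..j. e m\<bar> \<le> R" and "1 \<le> k" "k \<le> i" "i \<le> n" "k < n"
  shows "\<bar>right_sum n e k i\<bar> \<le> 6 * R"
proof -
  have tail: "\<bar>\<Sum>m=j..n. e m\<bar> \<le> 2 * R" if "1 \<le> j" "j \<le> n + 1" for j
  proof -
    have "j - 1 \<le> n" using that by auto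
    then show ?thesis
      unfolding sum_atLeastAtMost_diff[OF that] using R[of n] R[of "j - 1"] by linarith
  qed
  define c where "c = (real n + 1 - real i) / real (n - k)"
  define T where "T = (\<Sum>m=k+1..n. e m)"
  have "0 \<le> c" "c \<le> 2"
    using assms by (auto simp: c_def divide_le_eq of_nat_diff)
  moreover have "\<bar>T\<bar> \<le> 2 * R" using assms tail by (simp add: T_def)
  ultimately have "\<bar>c * T\<bar> \<le> 2 * (2 * R)" unfolding abs_mult by (intro mult_mono) auto
  moreover have "\<bar>\<Sum>m=i..n. e m\<bar> \<le> 2 * R" using assms by (intro tail) auto
  ultimately have "\<bar>(\<Sum>m=i..n. e m) - c * T\<bar> \<le> 2 * R + 2 * (2 * R)"
    by (intro order_trans[OF abs_triangle_ineq4] add_mono)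
  moreover have "right_sum n e k i = (\<Sum>m=i..n. e m) - c * T"
    unfolding c_def T_def using assms by (intro right_sum_eq) auto
  ultimately show ?thesis by simp
qed

text \<open>
  If the right sum from \<open>l + 1\<close> vanishes, then the partial sums at \<open>k\<close>, \<open>l\<close> and \<open>n\<close> lie on a line
  whose slope is the mean of the errors after \<open>k\<close>. As \<open>l\<close> is the midpoint of \<open>k\<close> and \<open>n\<close> up to
  rounding, their second difference is at most twice that slope, which is tiny because the noise is
  bounded by \<open>R\<close>.
\<close>

lemma right_sum_midpoint_nonzero:
  assumes R: "\<And>j. j \<le> n \<Longrightarrow> \<bar>\<Sum>m=1..j. e m\<bar> \<le> R" and "k \<le> l" "l < n"
    and mid: "\<bar>real n + real k - 2 * real l\<bar> \<le> 2"
    and curv: "4 * R / real (n - k) < \<bar>(\<Sum>m=1..n. e m) - 2 * (\<Sum>m=1..l. e m) + (\<Sum>m=1..k. e m)\<bar>"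
  shows "right_sum n e k (l + 1) \<noteq> 0"
proof
  assume 0: "right_sum n e k (l + 1) = 0"
  define S where "S j = (\<Sum>m=1..j. e m)" for j
  define c where "c = (S n - S k) / real (n - k)"
  have pos: "0 < real (n - k)" using assms by simp
  have tail: "(\<Sum>m=j+1..n. e m) = S n - S j" if "j \<le> n" for j
    using sum_atLeastAtMost_diff[of "j + 1" n e] that by (simp add: S_def)
  have "S n - S l = (real n - real l) * c"
    using 0 right_sum_eq[of "l + 1" n e k] tail[of l] tail[of k] assms by (simp add: c_def)
  moreover have "S n - S k = (real n - real k) * c"
    using pos assms by (simp add: c_def of_nat_diff)
  ultimately have "S n - 2 * S l + S k = (real n + real k - 2 * real l) * c"
    by (simp add: algebra_simps)
  then have "\<bar>S n - 2 * S l + S k\<bar> \<le> 2 * \<bar>c\<bar>"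
    using mid by (simp add: abs_mult mult_right_mono)
  also have "\<bar>c\<bar> \<le> 2 * R / real (n - k)"
  proof -
    have "\<bar>S n - S k\<bar> \<le> 2 * R" using R[of n] R[of k] assms unfolding S_def by linarith
    then show ?thesis using pos unfolding c_def by (simp add: divide_right_mono)
  qed
  finally show False using curv unfolding S_def by (simp add: field_simps)
qed

section \<open>Lower bounds for the three statistics\<close>

lemma finite_trimmed [simp]: "finite (trimmed \<delta> n)"
proof (rule finite_subset)
  show "trimmed \<delta> n \<subseteq> {..nat \<lceil>real n - real n * \<delta>\<rceil>}"
    by (auto simp: trimmed_def) linarith
qed simp

text \<open>
  The form in which the numerator and the denominator of a statistic are estimated. The denominator
  has to be positive because division by \<open>0\<close> yields \<open>0\<close>.
\<close>

lemma divide_bounds_le: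
  fixes p r :: real
  assumes "c * u \<le> p" "0 < r" "r \<le> u" "0 \<le> c"
  shows "c \<le> p / r"
proof -
  have "c * r \<le> c * u" using assms by (intro mult_left_mono)
  then show ?thesis using assms by (simp add: le_divide_eq)
qed

lemma V1_ge:
  assumes "k \<in> trimmed \<delta> n" "q \<in> {1..k}" "c * U \<le> \<bar>left_sum x k q\<bar>" "0 \<le> c"
    and U: "\<And>i. i \<in> {k..n} \<Longrightarrow> \<bar>right_sum n x k i\<bar> \<le> U"
    and r: "r \<in> {k..n}" "right_sum n x k r \<noteq> 0"
  shows "c \<le> V1 \<delta> n x"
proof -
  let ?num = "Max ((\<lambda>i. \<bar>left_sum x k i\<bar>) ` {1..k})" and ?den = "Max ((\<lambda>i. \<bar>right_sum n x k i\<bar>) ` {k..n})"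
  have "\<bar>left_sum x k q\<bar> \<le> ?num" using assms by (intro Max_ge) auto
  moreover have "\<bar>right_sum n x k r\<bar> \<le> ?den" using r by (intro Max_ge) auto
  moreover have "?den \<le> U" using U r by (intro Max.boundedI) auto
  ultimately have "c * U \<le> ?num" "0 < ?den" "?den \<le> U" using assms(3) r(2) by linarith+
  then have "c \<le> ?num / ?den" using assms(4) by (rule divide_bounds_le)
  also have "\<dots> \<le> V1 \<delta> n x" unfolding V1_def using assms(1) by (intro Max_ge) auto
  finally show ?thesis .
qed

text \<open>
  The sum over the full range is \<open>0\<close> on both sides of \<open>k\<close>. So the range of the left sums is at least as
  large as any single one in absolute value, and the range of the right sums is positive as soon as
  one of them is nonzero.
\<close>

lemma V2_ge:
  assumes "k \<in> trimmed \<delta> n" "q \<in> {1..k}" "k < n" "c * (2 * U) \<le> \<bar>left_sum x k q\<bar>" "0 \<le> c"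
    and U: "\<And>i. i \<in> {k+1..n} \<Longrightarrow> \<bar>right_sum n x k i\<bar> \<le> U"
    and r: "r \<in> {k+1..n}" "right_sum n x k r \<noteq> 0"
  shows "c \<le> V2 \<delta> n x"
proof -
  let ?L = "(\<lambda>i. left_sum x k i) ` {1..k}" and ?R = "(\<lambda>i. right_sum n x k i) ` {k+1..n}"
  have L: "left_sum x k q \<in> ?L" using assms(2) by blast
  have L0: "0 \<in> ?L" using assms(2) by (intro image_eqI[of _ _ k]) auto
  have R: "right_sum n x k r \<in> ?R" using r(1) by blast
  have R0: "0 \<in> ?R" using assms(3) by (intro image_eqI[of _ _ "k + 1"]) auto
  have fin: "finite ?L" "finite ?R" by auto
  have "\<bar>left_sum x k q\<bar> \<le> Max ?L - Min ?L"
    using Max_ge[OF fin(1) L] Max_ge[OF fin(1) L0] Min_le[OF fin(1) L] Min_le[OF fin(1) L0] by linarith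
  moreover have "0 < Max ?R - Min ?R"
    using Max_ge[OF fin(2) R] Max_ge[OF fin(2) R0] Min_le[OF fin(2) R] Min_le[OF fin(2) R0] r(2) by linarith
  moreover have "Max ?R \<le> U" using R U fin by (intro Max.boundedI) (auto simp: abs_le_iff)
  moreover have "- U \<le> Min ?R" using R U fin by (intro Min.boundedI) (force simp: abs_le_iff)+
  ultimately have "c * (2 * U) \<le> Max ?L - Min ?L" "0 < Max ?R - Min ?R" "Max ?R - Min ?R \<le> 2 * U"
    using assms(4) by linarith+
  then have "c \<le> (Max ?L - Min ?L) / (Max ?R - Min ?R)" using assms(5) by (rule divide_bounds_le)
  also have "\<dots> \<le> V2 \<delta> n x" unfolding V2_def using assms(1) by (intro Max_ge) auto
  finally show ?thesis .
qed

lemma centered_sum_of_squares: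
  fixes f :: "'i \<Rightarrow> real"
  assumes "finite A" "A \<noteq> {}"
  shows "(\<Sum>i\<in>A. (f i)\<^sup>2) - 1 / real (card A) * (\<Sum>i\<in>A. f i)\<^sup>2
       = (\<Sum>i\<in>A. (f i - (\<Sum>i\<in>A. f i) / real (card A))\<^sup>2)"
proof -
  define m where "m = (\<Sum>i\<in>A. f i) / real (card A)"
  have c: "real (card A) > 0" using assms by (simp add: card_gt_0_iff)
  have "(\<Sum>i\<in>A. (f i - m)\<^sup>2) = (\<Sum>i\<in>A. (f i)\<^sup>2) - 2 * m * (\<Sum>i\<in>A. f i) + real (card A) * m\<^sup>2"
    by (simp add: power2_diff sum.distrib sum_subtractf sum_distrib_left mult_ac
        flip: sum_distrib_left sum_distrib_right)
  also have "\<dots> = (\<Sum>i\<in>A. (f i)\<^sup>2) - 1 / real (card A) * (\<Sum>i\<in>A. f i)\<^sup>2"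
    using c by (simp add: m_def field_simps power2_eq_square)
  finally show ?thesis by (simp add: m_def)
qed

lemma half_square_diff_le:
  fixes u v m :: real
  shows "(u - v)\<^sup>2 / 2 \<le> (v - m)\<^sup>2 + (u - m)\<^sup>2"
proof -
  have "(u - v)\<^sup>2 \<le> ((v - m)\<^sup>2 + (u - m)\<^sup>2) * 2"
    using zero_le_power2[of "u + v - 2 * m"] by (simp add: power2_eq_square algebra_simps)
  then show ?thesis by (simp only: divide_le_eq_numeral1)
qed

text \<open>
  The sum of the squared deviations from the mean dominates the part that comes from the \<open>h\<close>
  disjoint pairs \<open>(i, i + h)\<close>, and two values at distance \<open>d\<close> contribute at least \<open>d\<^sup>2 / 2\<close> wherever the mean lies.
  This avoids computing the variance of the tent.
\<close>

lemma centered_sum_of_squares_ge: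
  fixes f :: "nat \<Rightarrow> real"
  assumes "2 * h \<le> k" "0 < k" "0 \<le> d"
    and d: "\<And>i. i \<in> {1..h} \<Longrightarrow> d \<le> \<bar>f (i + h) - f i\<bar>"
  shows "real h * (d\<^sup>2 / 2) \<le> (\<Sum>i=1..k. (f i)\<^sup>2) - 1 / real k * (\<Sum>i=1..k. f i)\<^sup>2"
proof -
  define m where "m = (\<Sum>i=1..k. f i) / real k"
  have "real h * (d\<^sup>2 / 2) = (\<Sum>i=1..h. d\<^sup>2 / 2)" by simp
  also have "\<dots> \<le> (\<Sum>i=1..h. (f i - m)\<^sup>2 + (f (i + h) - m)\<^sup>2)"
  proof (intro sum_mono)
    fix i assume "i \<in> {1..h}"
    then have "d\<^sup>2 \<le> (f (i + h) - f i)\<^sup>2"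
      using d assms(3) by (metis power2_abs power_mono)
    then show "d\<^sup>2 / 2 \<le> (f i - m)\<^sup>2 + (f (i + h) - m)\<^sup>2"
      using half_square_diff_le[of "f (i + h)" "f i" m] by linarith
  qed
  also have "\<dots> = (\<Sum>i=1..h. (f i - m)\<^sup>2) + (\<Sum>i=h+1..h+h. (f i - m)\<^sup>2)"
    using sum.shift_bounds_cl_nat_ivl[of "\<lambda>i. (f i - m)\<^sup>2" 1 h h] by (simp add: sum.distrib add.commute)
  also have "\<dots> = (\<Sum>i\<in>{1..h} \<union> {h+1..h+h}. (f i - m)\<^sup>2)"
    by (intro sum.union_disjoint[symmetric]) auto
  also have "\<dots> \<le> (\<Sum>i=1..k. (f i - m)\<^sup>2)" using assms(1) by (intro sum_mono2) auto
  also have "\<dots> = (\<Sum>i=1..k. (f i)\<^sup>2) - 1 / real k * (\<Sum>i=1..k. f i)\<^sup>2"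
    using centered_sum_of_squares[of "{1..k}" f] assms(2) by (simp add: m_def)
  finally show ?thesis .
qed

lemma V3_ge:
  assumes "k \<in> trimmed \<delta> n" "2 * h \<le> k" "0 < k" "k < n" "0 \<le> d"
    and c: "c * (real n * U\<^sup>2) \<le> real h * (d\<^sup>2 / 2)" "0 \<le> c"
    and d: "\<And>i. i \<in> {1..h} \<Longrightarrow> d \<le> \<bar>left_sum x k (i + h) - left_sum x k i\<bar>"
    and U: "\<And>i. i \<in> {k+1..n} \<Longrightarrow> \<bar>right_sum n x k i\<bar> \<le> U"
    and r: "r \<in> {k+1..n}" "right_sum n x k r \<noteq> 0"
  shows "c \<le> V3 \<delta> n x"
proof -
  let ?r = "\<lambda>i. right_sum n x k i"
  let ?num = "(\<Sum>i=1..k. (left_sum x k i)\<^sup>2) - 1 / real k * (\<Sum>i=1..k. left_sum x k i)\<^sup>2"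
    and ?den = "(\<Sum>i=k+1..n. (?r i)\<^sup>2) - 1 / real (n - k) * (\<Sum>i=k+1..n. ?r i)\<^sup>2"
  define m where "m = (\<Sum>i=k+1..n. ?r i) / real (n - k)"
  have den: "?den = (\<Sum>i=k+1..n. (?r i - m)\<^sup>2)"
    using centered_sum_of_squares[of "{k+1..n}" ?r] assms(4) by (simp add: m_def)
  \<comment> \<open>The first right sum vanishes and another one does not, so they are not all equal to their mean.\<close>
  have "0 < (\<Sum>i=k+1..n. (?r i - m)\<^sup>2)"
  proof (rule ccontr)
    assume "\<not> ?thesis"
    then have "(\<Sum>i=k+1..n. (?r i - m)\<^sup>2) = 0" by (meson antisym not_le sum_nonneg zero_le_power2)
    then have eq: "\<forall>i\<in>{k+1..n}. ?r i = m" by (subst (asm) sum_nonneg_eq_0_iff) auto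
    from eq[rule_format, of "k + 1"] eq[rule_format, of r] show False using assms(4) r by auto
  qed
  moreover have "?den \<le> real n * U\<^sup>2"
  proof -
    have "?den \<le> (\<Sum>i=k+1..n. (?r i)\<^sup>2)" by simp
    also have "\<dots> \<le> (\<Sum>i=k+1..n. U\<^sup>2)"
      using U by (intro sum_mono) (metis abs_ge_zero power2_abs power_mono)
    also have "\<dots> \<le> real n * U\<^sup>2" by (simp add: mult_right_mono)
    finally show ?thesis .
  qed
  moreover have "real h * (d\<^sup>2 / 2) \<le> ?num" using assms d by (intro centered_sum_of_squares_ge) auto
  ultimately have "c * (real n * U\<^sup>2) \<le> ?num" "0 < ?den" "?den \<le> real n * U\<^sup>2"
    unfolding den using c(1) by linarith+
  then have "c \<le> ?num / ?den" using c(2) by (rule divide_bounds_le)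
  also have "\<dots> \<le> V3 \<delta> n x" unfolding V3_def using assms(1) by (intro Max_ge) auto
  finally show ?thesis .
qed

text \<open>
  The deterministic core. Here \<open>q\<close> is the change, \<open>R\<close> bounds the partial sums of the errors, and
  \<open>k\<close>, \<open>l\<close> are the split point and the midpoint of the part after it. The tent rises by
  \<open>(k - q) / k * \<bar>a - b\<bar>\<close> at each step, so over \<open>h\<close> steps it rises by at least \<open>(4 + z) * R\<close>.
  A difference of two left sums carries noise at most \<open>4 * R\<close>, so \<open>z * R\<close> is left over. It is compared
  with right sums of size at most \<open>6 * R\<close>. The pairs
  \<open>(i, i + h)\<close> of the third statistic stay on the rising side of the tent because \<open>2 * h \<le> q\<close>.
\<close>

lemma statistics_ge_of_large_change:
  fixes x e :: "nat \<Rightarrow> real"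
  assumes before: "\<And>j. j \<in> {1..q} \<Longrightarrow> x j = a + e j" and after: "\<And>j. j \<in> {q+1..n} \<Longrightarrow> x j = b + e j"
    and R: "\<And>j. j \<le> n \<Longrightarrow> \<bar>\<Sum>m=1..j. e m\<bar> \<le> R" "0 < R"
    and idx: "1 \<le> q" "q < k" "k \<le> l" "l < n" "k \<in> trimmed \<delta> n" "2 * h \<le> q"
    and mid: "\<bar>real n + real k - 2 * real l\<bar> \<le> 2"
    and curv: "4 * R / real (n - k) < \<bar>(\<Sum>m=1..n. e m) - 2 * (\<Sum>m=1..l. e m) + (\<Sum>m=1..k. e m)\<bar>"
    and z: "0 \<le> z" "(4 + z) * R \<le> real h * ((real k - real q) / real k * \<bar>a - b\<bar>)"
  shows "z / 6 \<le> V1 \<delta> n x" "z / 12 \<le> V2 \<delta> n x" "real h / real n * (z\<^sup>2 / 72) \<le> V3 \<delta> n x"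
proof -
  define g where "g = (real k - real q) / real k * (a - b)"
  have absg: "\<bar>g\<bar> = (real k - real q) / real k * \<bar>a - b\<bar>" using idx by (simp add: g_def abs_mult)
  have left: "left_sum x k i = real i * g + left_sum e k i" if "i \<le> q" for i
    unfolding g_def using idx that before after by (intro left_sum_change_point) auto
  have left_noise: "\<bar>left_sum e k i\<bar> \<le> 2 * R" if "i \<le> k" for i
    using that idx R(1) by (intro abs_left_sum_le) auto
  have right: "right_sum n x k i = right_sum n e k i" if "i \<in> {k..n}" for i
    using that idx after by (intro right_sum_shift) auto
  have U: "\<bar>right_sum n x k i\<bar> \<le> 6 * R" if "i \<in> {k..n}" for i
    unfolding right[OF that] using that idx R(1) by (intro abs_right_sum_le) auto
  have nz: "right_sum n x k (l + 1) \<noteq> 0"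
    using right[of "l + 1"] right_sum_midpoint_nonzero[OF R(1) _ _ mid curv] idx by auto
  have "z * R \<le> \<bar>left_sum x k q\<bar>"
  proof -
    have "real h * \<bar>g\<bar> \<le> real q * \<bar>g\<bar>" using idx by (intro mult_right_mono) auto
    moreover have "\<bar>left_sum x k q\<bar> \<ge> \<bar>real q * g\<bar> - 2 * R"
      unfolding left[OF order_refl] using left_noise[of q] idx by linarith
    ultimately show ?thesis using z(2) R(2) unfolding absg[symmetric]
      by (simp add: abs_mult algebra_simps)
  qed
  then show "z / 6 \<le> V1 \<delta> n x" "z / 12 \<le> V2 \<delta> n x"
    using idx U nz z by (auto intro!: V1_ge[of k _ _ q "z / 6" "6 * R" _ "l + 1"]
      V2_ge[of k _ _ q "z / 12" "6 * R" _ "l + 1"] simp del: divide_le_eq_numeral1)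
  have "z * R \<le> \<bar>left_sum x k (i + h) - left_sum x k i\<bar>" if "i \<in> {1..h}" for i
  proof -
    have i: "i \<le> q" "i + h \<le> q" using that idx by auto
    have "left_sum x k (i + h) - left_sum x k i = real h * g + (left_sum e k (i + h) - left_sum e k i)"
      unfolding left[OF i(1)] left[OF i(2)] by (simp add: algebra_simps)
    moreover have "\<bar>left_sum e k (i + h) - left_sum e k i\<bar> \<le> 4 * R"
      using left_noise[of i] left_noise[of "i + h"] i idx by linarith
    moreover have "(4 + z) * R \<le> \<bar>real h * g\<bar>" using z(2) by (simp add: abs_mult absg)
    ultimately show ?thesis by (simp add: algebra_simps)
  qed
  moreover have "real h / real n * (z\<^sup>2 / 72) * (real n * (6 * R)\<^sup>2) \<le> real h * ((z * R)\<^sup>2 / 2)"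
    using idx by (simp add: power_mult_distrib)
  ultimately show "real h / real n * (z\<^sup>2 / 72) \<le> V3 \<delta> n x"
    using idx U nz z R(2) by (intro V3_ge[of k _ _ h "z * R" _ "6 * R" _ "l + 1"]) auto
qed

section \<open>Exceptional paths in the Skorokhod space\<close>

definition second_difference :: "real \<Rightarrow> (real \<Rightarrow> real) \<Rightarrow> real" where
  "second_difference s x = x 1 - 2 * x ((1 + s) / 2) + x s"

text \<open>
  The paths on which the deterministic estimate may fail at level \<open>r\<close>. One parameter governs both
  defects, so that these sets shrink as \<open>r\<close> grows, to a set that a scaled Wiener path avoids almost
  surely.
\<close>

definition exceptional_paths :: "real \<Rightarrow> real \<Rightarrow> (real \<Rightarrow> real) set" where
  "exceptional_paths s r =
     {x \<in> skorokhod_space. (\<exists>t\<in>{0..1}. r < \<bar>x t\<bar>) \<or> \<bar>second_difference s x\<bar> < 1 / r}"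

text \<open>
  Evaluation at a time is not continuous for the Skorokhod distance, but it is continuous at
  continuous paths: the time change moves the argument only a little, and the path is uniformly
  continuous. It applies to the limit, whose paths are continuous.
\<close>

lemma skorokhod_near_continuous:
  assumes "x \<in> skorokhod_space" "continuous_on {0..1} x" "0 < e"
  obtains d where "0 < d"
    "\<And>y t. y \<in> skorokhod_space \<Longrightarrow> skorokhod_dist x y < d \<Longrightarrow> t \<in> {0..1} \<Longrightarrow> \<bar>x t - y t\<bar> < e"
proof -
  have "uniformly_continuous_on {0..1} x"
    using assms(2) by (intro compact_uniformly_continuous) auto
  then obtain d where d: "0 < d"
    "\<And>s t. s \<in> {0..1} \<Longrightarrow> t \<in> {0..1} \<Longrightarrow> dist s t < d \<Longrightarrow> dist (x s) (x t) < e / 2"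
    unfolding uniformly_continuous_on_def using assms(3) half_gt_zero by metis
  show ?thesis
  proof (rule that[of "min d (e / 2)"])
    show "0 < min d (e / 2)" using d(1) assms(3) by simp
    fix y t assume y: "y \<in> skorokhod_space" "skorokhod_dist x y < min d (e / 2)" and t: "t \<in> {0..1::real}"
    obtain e' where e': "e' < min d (e / 2)" "skorokhod_close e' x y"
      using y assms(1) skorokhod_dist_less_iff by blast
    then obtain l where l: "l \<in> time_changes" "\<forall>t\<in>{0..1}. \<bar>l t - t\<bar> \<le> e'"
      "\<forall>t\<in>{0..1}. \<bar>x t - y (l t)\<bar> \<le> e'"
      by (auto simp: skorokhod_close_def)
    obtain u where u: "u \<in> {0..1}" "l u = t"
      using l(1) t unfolding time_changes_def by (metis (mono_tags, lifting) imageE mem_Collect_eq)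
    have "\<bar>t - u\<bar> \<le> e'" "\<bar>x u - y t\<bar> \<le> e'" using l(2,3) u by auto
    moreover have "dist (x u) (x t) < e / 2"
      using u(1) t e'(1) \<open>\<bar>t - u\<bar> \<le> e'\<close> by (intro d(2)) (auto simp: dist_real_def)
    ultimately show "\<bar>x t - y t\<bar> < e" using e'(1) unfolding dist_real_def by linarith
  qed
qed

text \<open>
  A path close to \<open>x\<close> is almost as bounded as \<open>x\<close> and has nearly the same second difference, and for
  large \<open>r\<close> both properties keep it out of the exceptional set.
\<close>

lemma continuous_path_away_from_exceptional:
  assumes "x \<in> skorokhod_space" "continuous_on {0..1} x" "second_difference s x \<noteq> 0" "s \<in> {0..1}"
  shows "\<forall>\<^sub>F r in at_top. \<forall>y\<in>exceptional_paths s r. 1 / r \<le> skorokhod_dist x y"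
proof -
  \<comment> \<open>The second difference moves by less than \<open>4 * e\<close> if the values at its three points move by less
    than \<open>e\<close>, and \<open>1 / r < e\<close>; any divisor of at least \<open>5\<close> gives a contradiction.\<close>
  define e where "e = \<bar>second_difference s x\<bar> / 8"
  have e: "0 < e" using assms(3) by (simp add: e_def)
  obtain d where d: "0 < d"
    "\<And>y t. y \<in> skorokhod_space \<Longrightarrow> skorokhod_dist x y < d \<Longrightarrow> t \<in> {0..1} \<Longrightarrow> \<bar>x t - y t\<bar> < e"
    using skorokhod_near_continuous[OF assms(1,2) e] by blast
  obtain B where B: "\<And>t. t \<in> {0..1} \<Longrightarrow> \<bar>x t\<bar> \<le> B" using skorokhod_space_bounded[OF assms(1)] by metis
  have "((\<lambda>r::real. 1 / r) \<longlongrightarrow> 0) at_top"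
    using tendsto_inverse_0_at_top[OF filterlim_ident] by (simp add: inverse_eq_divide)
  then have "\<forall>\<^sub>F r in at_top. 1 / r < min d e" using d(1) e by (intro order_tendstoD) auto
  with eventually_ge_at_top[of "B + e"] show ?thesis
  proof eventually_elim
    case (elim r)
    show ?case
    proof (rule ballI, rule ccontr)
      fix y assume y: "y \<in> exceptional_paths s r" "\<not> 1 / r \<le> skorokhod_dist x y"
      have close: "\<bar>x t - y t\<bar> < e" if "t \<in> {0..1}" for t
        using y elim that by (intro d(2)) (auto simp: exceptional_paths_def)
      have "\<bar>y t\<bar> \<le> r" if "t \<in> {0..1}" for t using close[OF that] B[OF that] elim by linarith
      then have "\<bar>second_difference s y\<bar> < 1 / r" using y(1) by (force simp: exceptional_paths_def)
      moreover have "\<bar>second_difference s x - second_difference s y\<bar> < 4 * e"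
        using close[of 1] close[of s] close[of "(1 + s) / 2"] assms(4) by (auto simp: second_difference_def)
      ultimately have "\<bar>second_difference s x\<bar> < 5 * e" using elim by linarith
      then show False using e by (simp add: e_def)
    qed
  qed
qed

text \<open>
  The points at distance at least \<open>e\<close> from \<open>A\<close> form a closed set disjoint from the closure of \<open>A\<close>, and
  metric spaces are normal, so Urysohn's lemma applies. The resulting function is a legitimate test
  function for weak convergence.
\<close>

lemma skorokhod_bump:
  assumes "A \<subseteq> skorokhod_space" "0 < e"
  obtains f where "continuous_map skorokhod.mtopology euclideanreal f"
    "\<And>x. x \<in> skorokhod_space \<Longrightarrow> 0 \<le> f x \<and> f x \<le> 1" "\<And>x. x \<in> A \<Longrightarrow> f x = 1"
    "\<And>x. x \<in> skorokhod_space \<Longrightarrow> \<forall>y\<in>A. e \<le> skorokhod_dist x y \<Longrightarrow> f x = 0"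
proof -
  let ?T = "skorokhod.mtopology"
  let ?far = "skorokhod_space - (\<Union>y\<in>A. skorokhod.mball y e)"
  have "closedin ?T ?far" by (auto intro!: closedin_diff openin_Union simp: closedin_def)
  moreover have "closedin ?T (?T closure_of A)" by simp
  moreover have "disjnt ?far (?T closure_of A)"
    using assms(2) skorokhod.commute
    unfolding disjnt_iff skorokhod.metric_closure_of by fastforce
  ultimately obtain f where f: "continuous_map ?T (top_of_set {0..1::real}) f"
      "f ` ?far \<subseteq> {0}" "f ` (?T closure_of A) \<subseteq> {1}"
    using Urysohn_lemma[OF skorokhod.normal_space_mtopology _ _ _ zero_le_one] by metis
  show ?thesis
  proof (rule that[of f])
    show "continuous_map ?T euclideanreal f" using f(1) continuous_map_in_subtopology by blast
    show "0 \<le> f x \<and> f x \<le> 1" if "x \<in> skorokhod_space" for x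
      using f(1) that by (auto simp: continuous_map_in_subtopology)
    show "f x = 1" if "x \<in> A" for x
      using f(3) closure_of_subset[of A ?T] assms(1) that by auto
    show "f x = 0" if "x \<in> skorokhod_space" "\<forall>y\<in>A. e \<le> skorokhod_dist x y" for x
    proof -
      have "x \<in> ?far" using that skorokhod.commute by fastforce
      then show ?thesis using f(2) by blast
    qed
  qed
qed

lemma space_skorokhod_borel [simp]: "space skorokhod_borel = skorokhod_space"
  and sets_skorokhod_borel: "openin skorokhod.mtopology U \<Longrightarrow> U \<in> sets skorokhod_borel"
proof -
  have *: "{U. openin skorokhod.mtopology U} \<subseteq> Pow skorokhod_space"
    using openin_subset[of skorokhod.mtopology] by auto
  show "space skorokhod_borel = skorokhod_space" unfolding skorokhod_borel_def by (rule space_measure_of[OF *])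
  show "U \<in> sets skorokhod_borel" if "openin skorokhod.mtopology U"
    unfolding skorokhod_borel_def sets_measure_of[OF *] using that by (intro sigma_sets.Basic) simp
qed

lemma continuous_map_borel_measurable:
  assumes "continuous_map skorokhod.mtopology euclideanreal f"
  shows "f \<in> borel_measurable skorokhod_borel"
proof (rule borel_measurableI)
  fix S :: "real set" assume "open S"
  then have "openin skorokhod.mtopology {x \<in> skorokhod_space. f x \<in> S}"
    using openin_continuous_map_preimage[OF assms, of S] by simp
  moreover have "{x \<in> skorokhod_space. f x \<in> S} = f -` S \<inter> space skorokhod_borel" by auto
  ultimately show "f -` S \<inter> space skorokhod_borel \<in> sets skorokhod_borel"
    using sets_skorokhod_borel by metis
qed

text \<open>
  The second difference is the difference of two increments over adjacent intervals of equal length.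
  These are independent and normal, so it has a density and does not charge \<open>0\<close>.
\<close>

lemma wiener_second_difference_nonzero:
  assumes W: "wiener_process N W" and s: "0 \<le> s" "s < 1"
  shows "AE \<omega> in N. W 1 \<omega> - 2 * W ((1 + s) / 2) \<omega> + W s \<omega> \<noteq> 0"
proof -
  interpret N: prob_space N using W by (simp add: wiener_process_def)
  define p where "p = (\<lambda>i::nat. s + real i * ((1 - s) / 2))"
  define Y where "Y = (\<lambda>i \<omega>. W (p (Suc i)) \<omega> - W (p i) \<omega>)"
  \<comment> \<open>Signs that turn the difference of the two increments into a sum.\<close>
  define c where "c = (\<lambda>i::nat. if i = 0 then - 1 else 1 :: real)"
  have pos: "0 < (1 - s) / 2" using s by simp
  have p0: "0 \<le> p 0" and pm: "strict_mono_on {..2} p"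
    using s pos unfolding p_def by (auto intro!: strict_mono_onI mult_strict_right_mono)
  have "N.indep_vars (\<lambda>_. borel) Y {..<2}"
    using W p0 pm unfolding wiener_process_def Y_def by blast
  then have indep: "N.indep_vars (\<lambda>_. borel) (\<lambda>i \<omega>. c i * Y i \<omega>) {..<2}"
    by (rule N.indep_vars_compose2) simp
  have normal: "distributed N lborel (\<lambda>\<omega>. c i * Y i \<omega>) (normal_density 0 (sqrt ((1 - s) / 2)))" for i
  proof -
    have "0 \<le> p i" "p i < p (Suc i)" "p (Suc i) - p i = (1 - s) / 2"
      using s pos unfolding p_def by (simp_all add: add_nonneg_nonneg) (simp_all add: field_simps)
    then have "distributed N lborel (Y i) (normal_density 0 (sqrt ((1 - s) / 2)))"
      using W unfolding wiener_process_def Y_def by metis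
    then have "distributed N lborel (\<lambda>\<omega>. 0 + c i * Y i \<omega>)
        (normal_density (0 + c i * 0) (\<bar>c i\<bar> * sqrt ((1 - s) / 2)))"
      using pos by (intro N.normal_density_affine) (auto simp: c_def)
    then show ?thesis by (simp add: c_def split: if_splits)
  qed
  have variance: "(\<Sum>i<2::nat. (sqrt ((1 - s) / 2))\<^sup>2) = 1 - s" using s by simp
  have "distributed N lborel (\<lambda>\<omega>. \<Sum>i<2. c i * Y i \<omega>)
      (normal_density (\<Sum>i<2::nat. 0) (sqrt (\<Sum>i<2::nat. (sqrt ((1 - s) / 2))\<^sup>2)))"
    using indep normal pos by (intro N.sum_indep_normal) (auto simp: lessThan_empty_iff)
  then have D: "distributed N lborel (\<lambda>\<omega>. \<Sum>i<2. c i * Y i \<omega>) (normal_density 0 (sqrt (1 - s)))"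
    unfolding variance by simp
  have "AE z in lborel. z \<noteq> (0::real)" by (rule AE_lborel_singleton)
  then have "AE \<omega> in N. (\<Sum>i<2. c i * Y i \<omega>) \<noteq> 0"
    by (subst N.distributed_AE2[OF D]) auto
  moreover have "(\<Sum>i<2. c i * Y i \<omega>) = W 1 \<omega> - 2 * W ((1 + s) / 2) \<omega> + W s \<omega>" for \<omega>
  proof -
    have p: "p 0 = s" "p 1 = (1 + s) / 2" "p 2 = 1" by (simp_all add: p_def field_simps)
    have "(\<Sum>i<2. c i * Y i \<omega>) = - (W (p 1) \<omega> - W (p 0) \<omega>) + (W (p 2) \<omega> - W (p 1) \<omega>)"
      by (simp add: c_def Y_def numeral_2_eq_2)
    then show ?thesis unfolding p by simp
  qed
  ultimately show ?thesis by simp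
qed

text \<open>
  Let \<open>f j\<close> be a test function equal to \<open>1\<close> on the exceptional paths of level \<open>j + 1\<close> and to \<open>0\<close> away
  from them. Along almost every limit path \<open>f j\<close> vanishes for large \<open>j\<close>, so some \<open>f j\<close> has expectation
  below \<open>e\<close> under the limit, hence under \<open>Y n\<close> for large \<open>n\<close>. Markov's inequality then bounds the
  probability that \<open>f j\<close> equals \<open>1\<close>. The good event \<open>G n\<close> is defined through \<open>f j\<close>, which makes it
  measurable without any discussion of the exceptional set itself.
\<close>

lemma eventually_exceptional_paths_unlikely:
  assumes M: "prob_space M" and W: "wiener_process N W" and s: "0 \<le> s" "s < 1" and \<sigma>: "0 < \<sigma>"
    and conv: "converges_weakly_skorokhod M Y N (\<lambda>\<omega>. restrict (\<lambda>t. \<sigma> * W t \<omega>) {0..1})"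
    and e: "0 < e"
  obtains r G where "0 < r" "\<forall>\<^sub>F n in sequentially. G n \<in> sets M \<and> 1 - e < measure M (G n) \<and>
    (\<forall>\<omega>\<in>G n. Y n \<omega> \<notin> exceptional_paths s r)"
proof -
  interpret M: prob_space M by (rule M)
  interpret N: prob_space N using W by (simp add: wiener_process_def)
  define Z where "Z = (\<lambda>\<omega>. restrict (\<lambda>t. \<sigma> * W t \<omega>) {0..1})"
  have Y: "Y n \<in> measurable M skorokhod_borel" for n
    using conv by (simp add: converges_weakly_skorokhod_def)
  have Z: "Z \<in> measurable N skorokhod_borel"
    using conv by (simp add: converges_weakly_skorokhod_def Z_def)
  have Z_space: "Z \<omega> \<in> skorokhod_space" if "\<omega> \<in> space N" for \<omega>
    using measurable_space[OF Z that] by simp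
  have Y_space: "Y n \<omega> \<in> skorokhod_space" if "\<omega> \<in> space M" for n \<omega>
    using measurable_space[OF Y that] by simp
  have Z_cont: "continuous_on {0..1} (Z \<omega>)" if "\<omega> \<in> space N" for \<omega>
  proof -
    have "continuous_on {0..} (\<lambda>t. W t \<omega>)" using W that by (simp add: wiener_process_def)
    then have "continuous_on {0..1} (\<lambda>t. \<sigma> * W t \<omega>)"
      by (intro continuous_on_mult_left) (auto elim: continuous_on_subset)
    then show ?thesis by (subst continuous_on_cong[OF refl]) (auto simp: Z_def)
  qed
  define R where "R j = real (Suc j)" for j
  have "\<forall>j. \<exists>f. continuous_map skorokhod.mtopology euclideanreal f \<and>
    (\<forall>x\<in>skorokhod_space. 0 \<le> f x \<and> f x \<le> 1) \<and> (\<forall>x\<in>exceptional_paths s (R j). f x = 1) \<and>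
    (\<forall>x\<in>skorokhod_space. (\<forall>y\<in>exceptional_paths s (R j). 1 / R j \<le> skorokhod_dist x y) \<longrightarrow> f x = 0)"
  proof
    fix j
    have "exceptional_paths s (R j) \<subseteq> skorokhod_space" "0 < 1 / R j"
      by (auto simp: exceptional_paths_def R_def)
    from skorokhod_bump[OF this] show "\<exists>f. continuous_map skorokhod.mtopology euclideanreal f \<and>
    (\<forall>x\<in>skorokhod_space. 0 \<le> f x \<and> f x \<le> 1) \<and> (\<forall>x\<in>exceptional_paths s (R j). f x = 1) \<and>
    (\<forall>x\<in>skorokhod_space. (\<forall>y\<in>exceptional_paths s (R j). 1 / R j \<le> skorokhod_dist x y) \<longrightarrow> f x = 0)"
      by metis
  qed
  then obtain f where cont: "\<And>j. continuous_map skorokhod.mtopology euclideanreal (f j)"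
    and range: "\<And>j x. x \<in> skorokhod_space \<Longrightarrow> 0 \<le> f j x \<and> f j x \<le> 1"
    and one: "\<And>j x. x \<in> exceptional_paths s (R j) \<Longrightarrow> f j x = 1"
    and zero: "\<And>j x. x \<in> skorokhod_space \<Longrightarrow>
        \<forall>y\<in>exceptional_paths s (R j). 1 / R j \<le> skorokhod_dist x y \<Longrightarrow> f j x = 0"
    by metis
  note f_meas = continuous_map_borel_measurable[OF cont]
  have "(\<lambda>j. \<integral>\<omega>. f j (Z \<omega>) \<partial>N) \<longlonglongrightarrow> (\<integral>\<omega>. 0 \<partial>N)"
  proof (rule integral_dominated_convergence)
    show "AE \<omega> in N. (\<lambda>j. f j (Z \<omega>)) \<longlonglongrightarrow> 0"
      using wiener_second_difference_nonzero[OF W s] AE_space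
    proof eventually_elim
      case (elim \<omega>)
      have "second_difference s (Z \<omega>) = \<sigma> * (W 1 \<omega> - 2 * W ((1 + s) / 2) \<omega> + W s \<omega>)"
        using s by (simp add: second_difference_def Z_def algebra_simps)
      then have "second_difference s (Z \<omega>) \<noteq> 0" using elim \<sigma> by simp
      then have "\<forall>\<^sub>F r in at_top. \<forall>y\<in>exceptional_paths s r. 1 / r \<le> skorokhod_dist (Z \<omega>) y"
        using elim s by (intro continuous_path_away_from_exceptional Z_space Z_cont) auto
      moreover have "filterlim R at_top sequentially"
        unfolding R_def by (rule filterlim_compose[OF filterlim_real_sequentially filterlim_Suc])
      ultimately have "\<forall>\<^sub>F j in sequentially. \<forall>y\<in>exceptional_paths s (R j). 1 / R j \<le> skorokhod_dist (Z \<omega>) y"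
        by (rule eventually_compose_filterlim)
      then have "\<forall>\<^sub>F j in sequentially. f j (Z \<omega>) = 0"
        by eventually_elim (use zero Z_space elim in blast)
      then show ?case by (rule tendsto_eventually)
    qed
    show "AE \<omega> in N. norm (f j (Z \<omega>)) \<le> 1" for j using range Z_space by (auto intro!: AE_I2)
  qed (use measurable_compose[OF Z f_meas] in auto)
  then have "\<forall>\<^sub>F j in sequentially. (\<integral>\<omega>. f j (Z \<omega>) \<partial>N) < e"
    using e by (intro order_tendstoD(2)) auto
  then obtain j where j: "(\<integral>\<omega>. f j (Z \<omega>) \<partial>N) < e" by (auto simp: eventually_sequentially)
  define G where "G n = {\<omega> \<in> space M. f j (Y n \<omega>) < 1}" for n
  have meas: "(\<lambda>\<omega>. f j (Y n \<omega>)) \<in> borel_measurable M" for n using measurable_compose[OF Y f_meas] .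
  have "bounded (f j ` skorokhod_space)"
    using range by (intro boundedI[of _ 1]) auto
  then have "(\<lambda>n. \<integral>\<omega>. f j (Y n \<omega>) \<partial>M) \<longlonglongrightarrow> (\<integral>\<omega>. f j (Z \<omega>) \<partial>N)"
    using conv cont[of j] unfolding converges_weakly_skorokhod_def Z_def by blast
  then have "\<forall>\<^sub>F n in sequentially. (\<integral>\<omega>. f j (Y n \<omega>) \<partial>M) < e" using j by (rule order_tendstoD(2))
  then have "\<forall>\<^sub>F n in sequentially. G n \<in> sets M \<and> 1 - e < measure M (G n) \<and>
    (\<forall>\<omega>\<in>G n. Y n \<omega> \<notin> exceptional_paths s (R j))"
  proof eventually_elim
    case (elim n)
    have G: "G n \<in> sets M" unfolding G_def using meas[of n] by measurable
    have int: "integrable M (\<lambda>\<omega>. f j (Y n \<omega>))"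
      using meas range Y_space by (intro M.integrable_const_bound[of _ 1]) (auto intro!: AE_I2)
    have "measure M {\<omega> \<in> space M. 1 \<le> f j (Y n \<omega>)} \<le> (\<integral>\<omega>. f j (Y n \<omega>) \<partial>M) / 1"
      using int range Y_space by (intro integral_Markov_inequality_measure[where A = "{}"]) (auto intro!: AE_I2)
    moreover have "{\<omega> \<in> space M. 1 \<le> f j (Y n \<omega>)} = space M - G n" by (auto simp: G_def)
    ultimately have "1 - e < measure M (G n)" using M.prob_compl[OF G] elim by simp
    moreover have "Y n \<omega> \<notin> exceptional_paths s (R j)" if "\<omega> \<in> G n" for \<omega>
      using one that by (force simp: G_def)
    ultimately show ?case using G by blast
  qed
  then show ?thesis by (intro that[of "R j" G]) (simp add: R_def)
qed

section \<open>Measurability of the statistics\<close>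

text \<open>
  Nonmeasurable sets have measure \<open>0\<close>, so the events in the definition of divergence in probability
  have to be measurable for the lower bounds to apply. Since \<open>0 < \<delta>\<close> and \<open>0 < n\<close>, every admissible
  \<open>k\<close> lies in \<open>{1..n}\<close>, and only the observations with these indices enter.
\<close>

lemma borel_measurable_V:
  assumes "\<And>k. k \<in> {1..n} \<Longrightarrow> (\<lambda>\<omega>. x \<omega> k) \<in> borel_measurable M"
    and "0 < \<delta>" "0 < n"
  shows "(\<lambda>\<omega>. V1 \<delta> n (x \<omega>)) \<in> borel_measurable M"
    "(\<lambda>\<omega>. V2 \<delta> n (x \<omega>)) \<in> borel_measurable M"
    "(\<lambda>\<omega>. V3 \<delta> n (x \<omega>)) \<in> borel_measurable M"
proof -
  have meas: "(\<lambda>\<omega>. x \<omega> k) \<in> borel_measurable M" if "1 \<le> k" "k \<le> n" for k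
    using assms that by simp
  have trimmed: "1 \<le> k" "k \<le> n" if "k \<in> trimmed \<delta> n" for k
  proof -
    have "0 < real n * \<delta>" using assms by simp
    moreover have "real n * \<delta> \<le> real k" "real k \<le> real n - real n * \<delta>" using that by (auto simp: trimmed_def)
    ultimately have "0 < real k" "real k < real n" by linarith+
    then show "1 \<le> k" "k \<le> n" by auto
  qed
  have left: "(\<lambda>\<omega>. left_sum (x \<omega>) k i) \<in> borel_measurable M" if "i \<le> k" "k \<le> n" for k i
    unfolding left_sum_def left_mean_def using that by (auto intro!: borel_measurable_sum borel_measurable_diff borel_measurable_divide meas)
  have right: "(\<lambda>\<omega>. right_sum n (x \<omega>) k i) \<in> borel_measurable M" if "1 \<le> i" for k i
    unfolding right_sum_def right_mean_def using that by (auto intro!: borel_measurable_sum borel_measurable_diff borel_measurable_divide meas)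
  show "(\<lambda>\<omega>. V1 \<delta> n (x \<omega>)) \<in> borel_measurable M"
    unfolding V1_def using trimmed
    by (intro borel_measurable_Max finite_trimmed borel_measurable_divide borel_measurable_abs left right) force+
  show "(\<lambda>\<omega>. V2 \<delta> n (x \<omega>)) \<in> borel_measurable M"
    unfolding V2_def using trimmed
    by (intro borel_measurable_Max borel_measurable_Min finite_trimmed borel_measurable_divide
        borel_measurable_diff left right) force+
  show "(\<lambda>\<omega>. V3 \<delta> n (x \<omega>)) \<in> borel_measurable M"
    unfolding V3_def using trimmed
    by (intro borel_measurable_Max finite_trimmed borel_measurable_divide borel_measurable_diff
        borel_measurable_sum borel_measurable_times borel_measurable_power borel_measurable_const left right) force+
qed

section \<open>Typical paths and the size of the change\<close>

lemma partial_sum_process_eq: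
  assumes "t \<in> {0..1}"
  shows "partial_sum_process \<epsilon> n \<omega> t = (\<Sum>i=1..nat \<lfloor>real n * t\<rfloor>. \<epsilon> i \<omega>) / sqrt (real n)"
proof -
  have "0 \<le> real n * t" using assms by simp
  then have "{i. 1 \<le> i \<and> real i \<le> real n * t} = {1..nat \<lfloor>real n * t\<rfloor>}"
    by (auto simp: le_nat_iff le_floor_iff)
  then show ?thesis using assms by (simp add: partial_sum_process_def)
qed

lemma typical_partial_sums:
  assumes "partial_sum_process \<epsilon> n \<omega> \<in> skorokhod_space"
    and typical: "partial_sum_process \<epsilon> n \<omega> \<notin> exceptional_paths s r" and n: "0 < n" and s: "s \<in> {0..1}"
  shows "j \<le> n \<Longrightarrow> \<bar>\<Sum>i=1..j. \<epsilon> i \<omega>\<bar> \<le> r * sqrt (real n)"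
    and "sqrt (real n) / r \<le> \<bar>(\<Sum>i=1..n. \<epsilon> i \<omega>) - 2 * (\<Sum>i=1..nat \<lfloor>real n * ((1 + s) / 2)\<rfloor>. \<epsilon> i \<omega>)
      + (\<Sum>i=1..nat \<lfloor>real n * s\<rfloor>. \<epsilon> i \<omega>)\<bar>"
proof -
  let ?x = "partial_sum_process \<epsilon> n \<omega>"
  have root: "0 < sqrt (real n)" using n by simp
  have bound: "\<bar>?x t\<bar> \<le> r" if "t \<in> {0..1}" for t
    using assms(1) typical that unfolding exceptional_paths_def by force
  show "\<bar>\<Sum>i=1..j. \<epsilon> i \<omega>\<bar> \<le> r * sqrt (real n)" if "j \<le> n"
  proof -
    have t: "real j / real n \<in> {0..1}" using that n by simp
    have "?x (real j / real n) = (\<Sum>i=1..j. \<epsilon> i \<omega>) / sqrt (real n)"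
      unfolding partial_sum_process_eq[OF t] using n by simp
    then show ?thesis using bound[OF t] root by (simp add: divide_le_eq)
  qed
  have "1 / r \<le> \<bar>second_difference s ?x\<bar>"
    using assms(1) typical unfolding exceptional_paths_def by auto
  moreover have "second_difference s ?x = ((\<Sum>i=1..n. \<epsilon> i \<omega>)
      - 2 * (\<Sum>i=1..nat \<lfloor>real n * ((1 + s) / 2)\<rfloor>. \<epsilon> i \<omega>) + (\<Sum>i=1..nat \<lfloor>real n * s\<rfloor>. \<epsilon> i \<omega>)) / sqrt (real n)"
  proof -
    have "1 \<in> {0..1::real}" "(1 + s) / 2 \<in> {0..1}" using s by auto
    then show ?thesis unfolding second_difference_def
      by (simp only: partial_sum_process_eq s) (simp add: diff_divide_distrib add_divide_distrib)
  qed
  ultimately show "sqrt (real n) / r \<le> \<bar>(\<Sum>i=1..n. \<epsilon> i \<omega>)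
      - 2 * (\<Sum>i=1..nat \<lfloor>real n * ((1 + s) / 2)\<rfloor>. \<epsilon> i \<omega>) + (\<Sum>i=1..nat \<lfloor>real n * s\<rfloor>. \<epsilon> i \<omega>)\<bar>"
    using root by (simp only: abs_divide) (simp add: le_divide_eq)
qed

text \<open>
  The indices are integer parts of fixed multiples of \<open>n\<close>, so for large \<open>n\<close> the lengths \<open>h = q div 2\<close>,
  \<open>k - q\<close> and \<open>n - k\<close> are at least fixed positive multiples of \<open>n\<close>. Then the rise
  \<open>h * (k - q) / k * \<bar>\<Delta> n\<bar>\<close> of the tent is at least a constant times \<open>\<surd>n\<close> times
  \<open>\<surd>n * \<bar>\<Delta> n\<bar>\<close>, which exceeds any multiple of the noise level \<open>r * \<surd>n\<close>.
\<close>

lemma eventually_statistics_large: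
  fixes \<Delta> :: "nat \<Rightarrow> real"
  assumes \<theta>: "0 < \<delta>" "\<delta> < \<theta>" "\<theta> < s" "s \<le> 1 - \<delta>" and r: "0 < r"
    and change: "filterlim (\<lambda>n. sqrt (real n) * \<bar>\<Delta> n\<bar>) at_top sequentially"
  shows "\<forall>\<^sub>F n in sequentially. \<forall>x e a b.
    (\<forall>j\<in>{1..nat \<lfloor>real n * \<theta>\<rfloor>}. x j = a + e j) \<longrightarrow> (\<forall>j\<in>{nat \<lfloor>real n * \<theta>\<rfloor>+1..n}. x j = b + e j) \<longrightarrow>
    \<Delta> n = a - b \<longrightarrow> (\<forall>j\<le>n. \<bar>\<Sum>i=1..j. e i\<bar> \<le> r * sqrt (real n)) \<longrightarrow>
    sqrt (real n) / r \<le> \<bar>(\<Sum>i=1..n. e i) - 2 * (\<Sum>i=1..nat \<lfloor>real n * ((1 + s) / 2)\<rfloor>. e i)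
      + (\<Sum>i=1..nat \<lfloor>real n * s\<rfloor>. e i)\<bar> \<longrightarrow>
    c < V1 \<delta> n x \<and> c < V2 \<delta> n x \<and> c < V3 \<delta> n x"
proof -
  have s1: "s < 1" and \<theta>0: "0 < \<theta>" using \<theta> by auto
  \<comment> \<open>The first summand serves the first two statistics. The second serves the third one, whose lower
    bound is \<open>\<theta> * z\<^sup>2 / 288\<close> because \<open>h / n\<close> is at least \<open>\<theta> / 4\<close>; note \<open>z\<^sup>2 \<ge> z\<close>.\<close>
  define z where "z = 12 * (\<bar>c\<bar> + 1) + 288 * (\<bar>c\<bar> + 1) / \<theta>"
  have frac: "0 < 288 * (\<bar>c\<bar> + 1) / \<theta>" using \<theta>0 by simp
  have z: "1 \<le> z" "c < z / 6" "c < z / 12" using frac by (auto simp: z_def)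
  have z3: "c < \<theta> / 4 * (z\<^sup>2 / 72)"
  proof -
    have "288 * c < \<theta> * (288 * (\<bar>c\<bar> + 1) / \<theta>)" using \<theta>0 by simp
    also have "\<dots> \<le> \<theta> * z" using \<theta>0 by (intro mult_left_mono) (auto simp: z_def)
    also have "\<dots> \<le> \<theta> * z\<^sup>2" using \<theta>0 z(1) self_le_power[of z 2] by simp
    finally show ?thesis by simp
  qed
  have grows: "\<forall>\<^sub>F n in sequentially. C \<le> real n * d" if "0 < d" for C d :: real
  proof -
    have "\<forall>\<^sub>F n in sequentially. C / d \<le> real n"
      using filterlim_real_sequentially by (simp add: filterlim_at_top)
    then show ?thesis by eventually_elim (use that in \<open>simp add: divide_le_eq\<close>)
  qed
  have "\<forall>\<^sub>F n in sequentially. (4 + z) * r * 8 / (\<theta> * (s - \<theta>)) \<le> sqrt (real n) * \<bar>\<Delta> n\<bar>"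
    using change by (simp add: filterlim_at_top)
  moreover have "\<forall>\<^sub>F n in sequentially. 4 \<le> real n * \<theta>" using \<theta>0 by (rule grows)
  moreover have "\<forall>\<^sub>F n in sequentially. 2 \<le> real n * (s - \<theta>)" using \<theta> by (intro grows) simp
  moreover have "\<forall>\<^sub>F n in sequentially. 4 * r\<^sup>2 + 1 \<le> real n * (1 - s)" using s1 by (intro grows) simp
  ultimately show ?thesis
  proof eventually_elim
    case (elim n)
    define q where "q = nat \<lfloor>real n * \<theta>\<rfloor>"
    define k where "k = nat \<lfloor>real n * s\<rfloor>"
    define l where "l = nat \<lfloor>real n * ((1 + s) / 2)\<rfloor>"
    define h where "h = q div 2"
    have n: "0 < real n" using elim(2) by (cases "n = 0") auto
    have floor_bounds: "real n * t - 1 < real (nat \<lfloor>real n * t\<rfloor>)" "real (nat \<lfloor>real n * t\<rfloor>) \<le> real n * t" if "0 \<le> t" for t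
    proof -
      have "real (nat \<lfloor>real n * t\<rfloor>) = of_int \<lfloor>real n * t\<rfloor>" using that by simp
      then show "real n * t - 1 < real (nat \<lfloor>real n * t\<rfloor>)" "real (nat \<lfloor>real n * t\<rfloor>) \<le> real n * t" by linarith+
    qed
    have q: "real n * \<theta> - 1 < real q" "real q \<le> real n * \<theta>" unfolding q_def using floor_bounds \<theta>0 by auto
    have k: "real n * s - 1 < real k" "real k \<le> real n * s" unfolding k_def using floor_bounds \<theta>0 \<theta> by auto
    have "real n * ((1 + s) / 2) - 1 < real l" "real l \<le> real n * ((1 + s) / 2)"
      unfolding l_def using \<theta>0 \<theta> floor_bounds[of "(1 + s) / 2"] by auto
    then have l: "real n + real n * s - 2 < 2 * real l" "2 * real l \<le> real n + real n * s"
      by (auto simp: field_simps)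
    have gap: "real n * (s - \<theta>) / 2 \<le> real k - real q"
      using q k elim(3) right_diff_distrib[of "real n" s \<theta>] by linarith
    have h: "real n * \<theta> / 4 \<le> real h"
    proof -
      have "real q \<le> 2 * real h + 1" unfolding h_def by linarith
      then show ?thesis using q elim(2) by linarith
    qed
    have ns: "real n * s < real n" using n s1 by simp
    have q1: "1 \<le> q" using q elim(2) by linarith
    have qk: "q < k" using gap elim(3) by simp
    have kl: "k \<le> l" unfolding k_def l_def using s1 n by (intro nat_mono floor_mono mult_left_mono) auto
    have ln: "l < n" using l ns by linarith
    have trim: "k \<in> trimmed \<delta> n"
    proof -
      have "real n * \<delta> \<le> real n * \<theta>" "real n * s \<le> real n * (1 - \<delta>)" using \<theta> by (auto intro!: mult_left_mono)
      then show ?thesis using gap q k elim(3) by (simp add: trimmed_def algebra_simps)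
    qed
    have hq: "2 * h \<le> q" by (simp add: h_def)
    have mid: "\<bar>real n + real k - 2 * real l\<bar> \<le> 2" using k l by linarith
    have curv: "4 * (r * sqrt (real n)) / real (n - k) < sqrt (real n) / r"
    proof -
      have "4 * r\<^sup>2 < real (n - k)" using k elim(4) ns by (simp add: of_nat_diff algebra_simps)
      then have "4 * (r * r) * sqrt (real n) < real (n - k) * sqrt (real n)"
        using n by (intro mult_strict_right_mono) (auto simp: power2_eq_square)
      moreover have "0 < real (n - k)" using k ns by simp
      ultimately show ?thesis using r by (simp add: field_simps)
    qed
    have size: "(4 + z) * (r * sqrt (real n)) \<le> real h * ((real k - real q) / real k * \<bar>\<Delta> n\<bar>)"
    proof -
      have sn: "sqrt (real n) * sqrt (real n) = real n" by simp
      have "(4 + z) * r * 8 \<le> sqrt (real n) * \<bar>\<Delta> n\<bar> * (\<theta> * (s - \<theta>))"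
        using elim(1) \<theta>0 \<theta> by (simp add: divide_le_eq)
      then have "(4 + z) * r * 8 * sqrt (real n) \<le> sqrt (real n) * \<bar>\<Delta> n\<bar> * (\<theta> * (s - \<theta>)) * sqrt (real n)"
        by (intro mult_right_mono) auto
      also have "\<dots> = real n * \<bar>\<Delta> n\<bar> * (\<theta> * (s - \<theta>))" by (subst (3) sn[symmetric]) (simp only: mult_ac)
      finally have "(4 + z) * (r * sqrt (real n)) \<le> real n * \<theta> / 4 * ((s - \<theta>) / 2 * \<bar>\<Delta> n\<bar>)"
        by (simp add: algebra_simps)
      also have "\<dots> \<le> real h * ((real k - real q) / real k * \<bar>\<Delta> n\<bar>)"
      proof (intro mult_mono h mult_right_mono)
        have "real k * (s - \<theta>) \<le> real n * (s - \<theta>)" using k ns \<theta> by (intro mult_right_mono) auto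
        then have "real k * ((s - \<theta>) / 2) \<le> real k - real q" using gap by simp
        then show "(s - \<theta>) / 2 \<le> (real k - real q) / real k" using qk by (simp add: le_divide_eq mult_ac)
      qed (use \<theta> qk in auto)
      finally show ?thesis .
    qed
    have root: "0 < r * sqrt (real n)" using r n by simp
    have bounds: "z / 6 \<le> V1 \<delta> n x \<and> z / 12 \<le> V2 \<delta> n x \<and> real h / real n * (z\<^sup>2 / 72) \<le> V3 \<delta> n x"
      if before: "\<forall>j\<in>{1..q}. x j = a + e j" and after: "\<forall>j\<in>{q+1..n}. x j = b + e j"
        and jump: "\<Delta> n = a - b" and noise: "\<forall>j\<le>n. \<bar>\<Sum>i=1..j. e i\<bar> \<le> r * sqrt (real n)"
        and bend: "sqrt (real n) / r \<le> \<bar>(\<Sum>i=1..n. e i) - 2 * (\<Sum>i=1..l. e i) + (\<Sum>i=1..k. e i)\<bar>" for x e a b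
    proof -
      have z0: "0 \<le> z" using z(1) by simp
      show ?thesis
        using statistics_ge_of_large_change[OF before[rule_format] after[rule_format] noise[rule_format]
            root q1 qk kl ln trim hq mid less_le_trans[OF curv bend] z0 size[unfolded jump]]
        by blast
    qed
    have "\<theta> / 4 * (z\<^sup>2 / 72) \<le> real h / real n * (z\<^sup>2 / 72)"
      using h n by (intro mult_right_mono) (auto simp: field_simps)
    then have V3: "c < V3 \<delta> n x" if "real h / real n * (z\<^sup>2 / 72) \<le> V3 \<delta> n x" for x
      using that z3 by linarith
    show ?case
    proof (intro allI impI)
      fix x e :: "nat \<Rightarrow> real" and a b :: real
      assume "\<forall>j\<in>{1..nat \<lfloor>real n * \<theta>\<rfloor>}. x j = a + e j" "\<forall>j\<in>{nat \<lfloor>real n * \<theta>\<rfloor>+1..n}. x j = b + e j"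
        "\<Delta> n = a - b" "\<forall>j\<le>n. \<bar>\<Sum>i=1..j. e i\<bar> \<le> r * sqrt (real n)"
        "sqrt (real n) / r \<le> \<bar>(\<Sum>i=1..n. e i) - 2 * (\<Sum>i=1..nat \<lfloor>real n * ((1 + s) / 2)\<rfloor>. e i)
          + (\<Sum>i=1..nat \<lfloor>real n * s\<rfloor>. e i)\<bar>"
      note bounds[unfolded q_def k_def l_def, OF this]
      then show "c < V1 \<delta> n x \<and> c < V2 \<delta> n x \<and> c < V3 \<delta> n x"
        using z(2,3) V3 by (auto intro: less_le_trans)
    qed
  qed
qed

section \<open>Divergence of the statistics\<close>

theorem theorem1p2:
  fixes M :: "'a measure" and N :: "'b measure"
    and \<epsilon> :: "nat \<Rightarrow> 'a \<Rightarrow> real" and W :: "real \<Rightarrow> 'b \<Rightarrow> real"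
    and X :: "nat \<Rightarrow> nat \<Rightarrow> 'a \<Rightarrow> real" and \<mu> :: "nat \<Rightarrow> nat \<Rightarrow> real"
    and kstar :: "nat \<Rightarrow> nat" and \<Delta> :: "nat \<Rightarrow> real"
    and \<delta> \<theta> \<sigma> :: real
  assumes "prob_space M"
    and "0 < \<delta>" and "\<delta> < 1/2"
    and mean_zero: "\<And>i. 1 \<le> i \<Longrightarrow> integrable M (\<epsilon> i) \<and> (\<integral>\<omega>. \<epsilon> i \<omega> \<partial>M) = 0"
    and "0 < \<sigma>"
    and "wiener_process N W"
    and fclt: "converges_weakly_skorokhod M (partial_sum_process \<epsilon>)
                 N (\<lambda>\<omega>. restrict (\<lambda>t. \<sigma> * W t \<omega>) {0..1})"
    and obs: "\<And>n k \<omega>. 1 \<le> k \<Longrightarrow> k \<le> n \<Longrightarrow> \<omega> \<in> space M \<Longrightarrow> X n k \<omega> = \<mu> n k + \<epsilon> k \<omega>"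
    and "0 < \<theta>" and "\<theta> < 1"
    and kstar: "\<And>n. kstar n = nat \<lfloor>real n * \<theta>\<rfloor>"
    and H_A: "\<And>n. 1 \<le> kstar n \<Longrightarrow> kstar n < n \<Longrightarrow> change_point n (\<mu> n) (kstar n)"
    and Delta: "\<And>n. \<Delta> n = \<mu> n (kstar n) - \<mu> n (kstar n + 1)"
    and "filterlim (\<lambda>n. sqrt (real n) * \<bar>\<Delta> n\<bar>) at_top sequentially"
    and "\<delta> < \<theta>" and "\<theta> < 1 - \<delta>"
  shows "diverges_in_probability M (\<lambda>n \<omega>. V1 \<delta> n (\<lambda>k. X n k \<omega>))
       \<and> diverges_in_probability M (\<lambda>n \<omega>. V2 \<delta> n (\<lambda>k. X n k \<omega>))
       \<and> diverges_in_probability M (\<lambda>n \<omega>. V3 \<delta> n (\<lambda>k. X n k \<omega>))"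
proof -
  interpret M: prob_space M by (rule assms(1))
  \<comment> \<open>Any split point strictly after the change and within the trimmed range would serve.\<close>
  define s where "s = (\<theta> + (1 - \<delta>)) / 2"
  have s: "\<theta> < s" "s \<le> 1 - \<delta>" "0 \<le> s" "s < 1" using assms by (auto simp: s_def)
  have S_space: "partial_sum_process \<epsilon> n \<omega> \<in> skorokhod_space" if "\<omega> \<in> space M" for n \<omega>
    using fclt that measurable_space[of "partial_sum_process \<epsilon> n" M skorokhod_borel \<omega>]
    by (simp add: converges_weakly_skorokhod_def)
  have X_meas: "(\<lambda>\<omega>. X n k \<omega>) \<in> borel_measurable M" if "k \<in> {1..n}" for n k
  proof -
    have "\<epsilon> k \<in> borel_measurable M" using mean_zero[of k] that by auto
    then have "(\<lambda>\<omega>. \<mu> n k + \<epsilon> k \<omega>) \<in> borel_measurable M" by simp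
    moreover have "X n k \<omega> = \<mu> n k + \<epsilon> k \<omega>" if "\<omega> \<in> space M" for \<omega>
      using obs[of k n \<omega>] that \<open>k \<in> {1..n}\<close> by simp
    ultimately show ?thesis by (subst measurable_cong[where g = "\<lambda>\<omega>. \<mu> n k + \<epsilon> k \<omega>"])
  qed
  have likely: "\<forall>\<^sub>F n in sequentially.
      1 - e < measure M {\<omega> \<in> space M. c < V1 \<delta> n (\<lambda>k. X n k \<omega>)} \<and>
      1 - e < measure M {\<omega> \<in> space M. c < V2 \<delta> n (\<lambda>k. X n k \<omega>)} \<and>
      1 - e < measure M {\<omega> \<in> space M. c < V3 \<delta> n (\<lambda>k. X n k \<omega>)}" if e: "0 < e" for c e :: real
  proof -
    obtain r G where r: "0 < r" and G: "\<forall>\<^sub>F n in sequentially. G n \<in> sets M \<and> 1 - e < measure M (G n) \<and>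
        (\<forall>\<omega>\<in>G n. partial_sum_process \<epsilon> n \<omega> \<notin> exceptional_paths s r)"
      by (rule eventually_exceptional_paths_unlikely[OF assms(1) \<open>wiener_process N W\<close> s(3,4) \<open>0 < \<sigma>\<close> fclt e])
    have "\<forall>\<^sub>F n in sequentially. 1 / \<theta> \<le> real n"
      using filterlim_real_sequentially by (simp add: filterlim_at_top)
    moreover note eventually_statistics_large[OF \<open>0 < \<delta>\<close> \<open>\<delta> < \<theta>\<close> s(1,2) r
        \<open>filterlim (\<lambda>n. sqrt (real n) * \<bar>\<Delta> n\<bar>) at_top sequentially\<close>, of c]
    ultimately show ?thesis using G eventually_gt_at_top[of 0]
    proof eventually_elim
      case (elim n)
      have "1 \<le> real n * \<theta>" using elim(1) \<open>0 < \<theta>\<close> by (simp add: divide_le_eq)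
      then have "1 \<le> kstar n" unfolding kstar by (simp add: le_nat_iff le_floor_iff)
      moreover have "real (kstar n) < real n"
      proof -
        have "real (kstar n) \<le> real n * \<theta>" unfolding kstar using \<open>0 < \<theta>\<close> by simp
        also have "\<dots> < real n" using elim(4) \<open>\<theta> < 1\<close> by simp
        finally show ?thesis .
      qed
      ultimately have cp: "change_point n (\<mu> n) (kstar n)" using H_A by simp
      have large: "c < V1 \<delta> n (\<lambda>k. X n k \<omega>) \<and> c < V2 \<delta> n (\<lambda>k. X n k \<omega>) \<and> c < V3 \<delta> n (\<lambda>k. X n k \<omega>)"
        if \<omega>: "\<omega> \<in> G n" for \<omega>
      proof -
        have space: "\<omega> \<in> space M" using \<omega> elim(3) sets.sets_into_space by blast
        have before: "\<forall>j\<in>{1..nat \<lfloor>real n * \<theta>\<rfloor>}. X n j \<omega> = \<mu> n (kstar n) + \<epsilon> j \<omega>"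
          unfolding kstar[symmetric]
        proof
          fix j assume j: "j \<in> {1..kstar n}"
          then have "\<mu> n j = \<mu> n (kstar n)" using cp unfolding change_point_def by blast
          moreover have "X n j \<omega> = \<mu> n j + \<epsilon> j \<omega>" using j cp space by (intro obs) (auto simp: change_point_def)
          ultimately show "X n j \<omega> = \<mu> n (kstar n) + \<epsilon> j \<omega>" by simp
        qed
        have after: "\<forall>j\<in>{nat \<lfloor>real n * \<theta>\<rfloor>+1..n}. X n j \<omega> = \<mu> n (kstar n + 1) + \<epsilon> j \<omega>"
          unfolding kstar[symmetric]
        proof
          fix j assume j: "j \<in> {kstar n + 1..n}"
          then have "\<mu> n j = \<mu> n (kstar n + 1)" using cp unfolding change_point_def by blast
          moreover have "X n j \<omega> = \<mu> n j + \<epsilon> j \<omega>" using j space by (intro obs) auto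
          ultimately show "X n j \<omega> = \<mu> n (kstar n + 1) + \<epsilon> j \<omega>" by simp
        qed
        have typical: "partial_sum_process \<epsilon> n \<omega> \<notin> exceptional_paths s r" using elim(3) \<omega> by blast
        have "s \<in> {0..1}" using s by simp
        note sums = typical_partial_sums[OF S_space[OF space] typical elim(4) this]
        then have "\<forall>j\<le>n. \<bar>\<Sum>i=1..j. \<epsilon> i \<omega>\<bar> \<le> r * sqrt (real n)" by blast
        from elim(2)[rule_format, OF before[rule_format] after[rule_format] Delta this[rule_format] sums(2)]
        show ?thesis .
      qed
      note V_meas = borel_measurable_V[OF X_meas \<open>0 < \<delta>\<close> elim(4)]
      have "1 - e < measure M {\<omega> \<in> space M. c < V \<omega>}"
        if "V \<in> borel_measurable M" "\<And>\<omega>. \<omega> \<in> G n \<Longrightarrow> c < V \<omega>" for V :: "'a \<Rightarrow> real"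
      proof -
        have "G n \<subseteq> {\<omega> \<in> space M. c < V \<omega>}" using that(2) elim(3) sets.sets_into_space by blast
        moreover have "{\<omega> \<in> space M. c < V \<omega>} \<in> sets M" using that(1) by measurable
        ultimately have "measure M (G n) \<le> measure M {\<omega> \<in> space M. c < V \<omega>}"
          by (rule M.finite_measure_mono)
        then show ?thesis using elim(3) by linarith
      qed
      then show ?case using V_meas large by simp
    qed
  qed
  have tends: "p \<longlonglongrightarrow> 1" if "\<And>e. 0 < e \<Longrightarrow> \<forall>\<^sub>F n in sequentially. 1 - e < p n" "\<And>n. p n \<le> 1" for p :: "nat \<Rightarrow> real"
  proof (rule tendstoI)
    fix e :: real assume "0 < e"
    from that(1)[OF this] show "\<forall>\<^sub>F n in sequentially. dist (p n) 1 < e"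
    proof eventually_elim
      case (elim n)
      then show ?case using that(2)[of n] by (simp add: dist_real_def abs_if)
    qed
  qed
  have "(\<lambda>n. measure M {\<omega> \<in> space M. c < V1 \<delta> n (\<lambda>k. X n k \<omega>)}) \<longlonglongrightarrow> 1"
    "(\<lambda>n. measure M {\<omega> \<in> space M. c < V2 \<delta> n (\<lambda>k. X n k \<omega>)}) \<longlonglongrightarrow> 1"
    "(\<lambda>n. measure M {\<omega> \<in> space M. c < V3 \<delta> n (\<lambda>k. X n k \<omega>)}) \<longlonglongrightarrow> 1" for c
    by (rule tends; simp add: likely[unfolded eventually_conj_iff] M.prob_le_1)+
  then show ?thesis unfolding diverges_in_probability_def by blast
qed

end
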